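(* For any $\lambda\in\mathbb{C}^*$, there exists an admissible Poisson bracket $\{\cdot,\cdot\}_\lambda$ on the algebra $\mathcal{M}_*^{\leq\infty}=\mathbb{C}[E_2,E_4,E_6]$ of quasimodular forms defined by the following values on the generators: $$\{E_4,E_6\}_\lambda=-2\Delta,\quad \{E_2,E_4\}_\lambda=-\frac{1}{3}\left(2E_6E_2-\lambda E_4^2\right),\quad \{E_2,E_6\}_\lambda=-\frac{1}{2}\left(2E_4^2E_2-\lambda E_4E_6\right).$$ Moreover: (i) for any $\lambda\in\mathbb{C}^*$, the Poisson bracket $\{\cdot,\cdot\}_\lambda$ is not unimodular; (ii) the Poisson algebras $(\mathcal{M}_*^{\leq\infty},\{\cdot,\cdot\}_\lambda)$ and $(\mathcal{M}_*^{\leq\infty},\{\cdot,\cdot\}_{\lambda'})$ are Poisson modular isomorphic for all $\lambda$ and $\lambda'$ in $\mathbb{C}^*$; (iii) for any $\lambda\in\mathbb{C}^*$, the Poisson center of $(\mathcal{M}_*^{\leq\infty},\{\cdot,\cdot\}_\lambda)$ is $\mathbb{C}$.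
   Context: Modular forms are for $\mathrm{SL}(2,\mathbb{Z})$. The Eisenstein series are $E_2=1-24\sum_{n\ge1}\sigma_1(n)q^n$, $E_4=1+240\sum_{n\ge1}\sigma_3(n)q^n$, $E_6=1-504\sum_{n\ge1}\sigma_5(n)q^n$, with $q=e^{2\pi i z}$; they are algebraically independent over $\mathbb{C}$. The algebra of modular forms is $\mathcal{M}_*=\mathbb{C}[E_4,E_6]$, and the algebra of quasimodular forms is $\mathcal{M}_*^{\leq\infty}=\mathbb{C}[E_2,E_4,E_6]$, graded by the weight ($E_j$ has weight $j$). $\mathcal{M}_k$ is the space of modular forms of weight $k$ (weight-$k$ part of $\mathcal{M}_*$), and $\mathcal{M}_k^{\leq s}=\bigoplus_{j=0}^s\mathcal{M}_{k-2j}E_2^j$ is the space of quasimodular forms of weight $k$ and depth (degree in $E_2$) at most $s$. $\Delta=E_4^3-E_6^2$. $D=\frac{1}{2\pi i}\frac{d}{dz}$, and $\mathrm{RC}_1$ is the first Rankin-Cohen bracket on $\mathcal{M}_*$, i.e. the bilinear extension of $\mathrm{RC}_1(f,g)=kfD(g)-\ell gD(f)$ for $f\in\mathcal{M}_k$, $g\in\mathcal{M}_\ell$ (so $\mathrm{RC}_1(E_4,E_6)=-2\Delta$). A Poisson bracket on a commutative $\mathbb{C}$-algebra is a bilinear skew-symmetric map satisfying the Leibniz rule in each argument and the Jacobi identity. A Poisson bracket $b$ on $\mathcal{M}_*^{\leq\infty}$ is admissible if (1) its restriction to $\mathcal{M}_*$ is $\mathrm{RC}_1$, and (2) $b(\mathcal{M}_k^{\leq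 s},\mathcal{M}_\ell^{\leq t})\subset\mathcal{M}_{k+\ell+2}^{\leq s+t}$ for all even $k,\ell$ and all integers $s,t\ge 0$. Identify $\mathcal{M}_*^{\leq\infty}$ with $\mathbb{C}[x,y,z]$ via $x=E_2$, $y=E_4$, $z=E_6$. For a Poisson bracket $b$ on $\mathbb{C}[x,y,z]$ put $r=b(x,y)$, $p=b(y,z)$, $q=b(z,x)$ and $\mathrm{curl}(p,q,r)=\left(\frac{\partial r}{\partial y}-\frac{\partial q}{\partial z},\frac{\partial p}{\partial z}-\frac{\partial r}{\partial x},\frac{\partial q}{\partial x}-\frac{\partial p}{\partial y}\right)$. The bracket $b$ is unimodular if there exists $k\in\mathbb{C}[x,y,z]$ with $\mathrm{curl}(p,q,r)=(p,q,r)\wedge\mathrm{grad}\,k$ ($\wedge$ is the cross product). A Poisson isomorphism (algebra isomorphism intertwining the brackets) $\varphi:(\mathcal{M}_*^{\leq\infty},b_1)\to(\mathcal{M}_*^{\leq\infty},b_2)$ is modular if $\varphi(\mathcal{M}_* )\subset\mathcal{M}_*$; two Poisson structures are Poisson modular isomorphic if such a $\varphi$ exists. The Poisson center of a Poisson algebra $(A,b)$ is $\{g\in A: b(f,g)=0\ \text{for all } f\in A\}$. *)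

theory Defs
  imports
    "HOL-Analysis.Analysis"
    "HOL-Computational_Algebra.Polynomial"
begin

text \<open>
  The algebra of quasimodular forms is \<open>\<complex>[E2, E4, E6]\<close> with algebraically independent
  \<open>E2, E4, E6\<close>, so it is the polynomial algebra \<open>\<complex>[x, y, z]\<close> with \<open>x = E2\<close>, \<open>y = E4\<close>, \<open>z = E6\<close>.
  It is represented by nested univariate polynomials: \<open>E2\<close> is the outermost variable, \<open>E4\<close> the
  middle one and \<open>E6\<close> the innermost one. The map \<open>qm_fun\<close> below sends such a polynomial to the
  holomorphic function on the upper half-plane that it stands for.
\<close>

type_synonym qmod = "complex poly poly poly"

definition const :: "complex \<Rightarrow> qmod"
  where "const c = [:[:[:c:]:]:]"

definition E2 :: qmod where "E2 = [:0, 1:]"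
definition E4 :: qmod where "E4 = [:[:0, 1:]:]"
definition E6 :: qmod where "E6 = [:[:[:0, 1:]:]:]"

definition Delta :: qmod where "Delta = E4 ^ 3 - E6 ^ 2"


text \<open>
  Functions on the upper half-plane; only their values at \<open>\<tau>\<close> with \<open>Im \<tau> > 0\<close> are meaningful.
\<close>

definition divisor_sum :: "nat \<Rightarrow> nat \<Rightarrow> nat"
  where "divisor_sum k n = (\<Sum>d | d dvd n. d ^ k)"

definition nome :: "complex \<Rightarrow> complex"
  where "nome \<tau> = exp (2 * of_real pi * \<i> * \<tau>)"

definition E2_fun :: "complex \<Rightarrow> complex"
  where "E2_fun \<tau> = 1 - 24 * (\<Sum>n. of_nat (divisor_sum 1 (Suc n)) * nome \<tau> ^ Suc n)"

definition E4_fun :: "complex \<Rightarrow> complex"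
  where "E4_fun \<tau> = 1 + 240 * (\<Sum>n. of_nat (divisor_sum 3 (Suc n)) * nome \<tau> ^ Suc n)"

definition E6_fun :: "complex \<Rightarrow> complex"
  where "E6_fun \<tau> = 1 - 504 * (\<Sum>n. of_nat (divisor_sum 5 (Suc n)) * nome \<tau> ^ Suc n)"

definition qm_fun :: "qmod \<Rightarrow> complex \<Rightarrow> complex"
  where "qm_fun f \<tau> = poly (poly (poly f [:[:E2_fun \<tau>:]:]) [:E4_fun \<tau>:]) (E6_fun \<tau>)"

definition D :: "(complex \<Rightarrow> complex) \<Rightarrow> complex \<Rightarrow> complex"
  where "D F \<tau> = deriv F \<tau> / (2 * of_real pi * \<i>)"

text \<open>The first Rankin-Cohen bracket of forms of weights \<open>k\<close> and \<open>l\<close>.\<close>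

definition RC1 :: "int \<Rightarrow> int \<Rightarrow> (complex \<Rightarrow> complex) \<Rightarrow> (complex \<Rightarrow> complex) \<Rightarrow> complex \<Rightarrow> complex"
  where "RC1 k l F G \<tau> = of_int k * F \<tau> * D G \<tau> - of_int l * G \<tau> * D F \<tau>"


text \<open>Polynomials of degree 0 in \<open>E2\<close>, that is, \<open>\<complex>[E4, E6]\<close>.\<close>

definition modular_algebra :: "qmod set"
  where "modular_algebra = range (\<lambda>g. [:g:])"

text \<open>The index set is finite for every \<open>k\<close>, and empty for \<open>k\<close> negative or odd.\<close>

definition modular_forms :: "int \<Rightarrow> qmod set"
  where "modular_forms k =
    {f. \<exists>c. f = (\<Sum>(a, b) \<in> {(a, b). 4 * int a + 6 * int b = k}. const (c a b) * E4 ^ a * E6 ^ b)}"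

definition quasimodular_forms :: "int \<Rightarrow> nat \<Rightarrow> qmod set"
  where "quasimodular_forms k s =
    {f. \<exists>m. (\<forall>j\<le>s. m j \<in> modular_forms (k - 2 * int j)) \<and> f = (\<Sum>j\<le>s. m j * E2 ^ j)}"


definition poisson_bracket :: "(qmod \<Rightarrow> qmod \<Rightarrow> qmod) \<Rightarrow> bool"
  where "poisson_bracket b \<longleftrightarrow>
    (\<forall>f g h. b (f + g) h = b f h + b g h) \<and>
    (\<forall>f g h. b f (g + h) = b f g + b f h) \<and>
    (\<forall>c f g. b (const c * f) g = const c * b f g) \<and>
    (\<forall>c f g. b f (const c * g) = const c * b f g) \<and>
    (\<forall>f g. b f g = - b g f) \<and>
    (\<forall>f g h. b (f * g) h = f * b g h + g * b f h) \<and>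
    (\<forall>f g h. b f (g * h) = g * b f h + h * b f g) \<and>
    (\<forall>f g h. b f (b g h) + b g (b h f) + b h (b f g) = 0)"

text \<open>
  The brackets concerned are bilinear, and the Rankin-Cohen bracket on all modular forms is the
  bilinear extension of its values on forms of pure weight; so the two agree on all modular forms
  as soon as they agree on forms of pure weight.
\<close>

definition restricts_to_RC1 :: "(qmod \<Rightarrow> qmod \<Rightarrow> qmod) \<Rightarrow> bool"
  where "restricts_to_RC1 b \<longleftrightarrow>
    (\<forall>f\<in>modular_algebra. \<forall>g\<in>modular_algebra. b f g \<in> modular_algebra) \<and>
    (\<forall>k l. \<forall>f\<in>modular_forms k. \<forall>g\<in>modular_forms l. \<forall>\<tau>. Im \<tau> > 0 \<longrightarrow>
       qm_fun (b f g) \<tau> = RC1 k l (qm_fun f) (qm_fun g) \<tau>)"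

definition admissible :: "(qmod \<Rightarrow> qmod \<Rightarrow> qmod) \<Rightarrow> bool"
  where "admissible b \<longleftrightarrow>
    poisson_bracket b \<and>
    restricts_to_RC1 b \<and>
    (\<forall>k l s t. even k \<longrightarrow> even l \<longrightarrow>
      (\<forall>f\<in>quasimodular_forms k s. \<forall>g\<in>quasimodular_forms l t.
        b f g \<in> quasimodular_forms (k + l + 2) (s + t)))"


text \<open>Partial derivatives with respect to \<open>x = E2\<close>, \<open>y = E4\<close> and \<open>z = E6\<close>.\<close>

definition dx :: "qmod \<Rightarrow> qmod" where "dx = pderiv"
definition dy :: "qmod \<Rightarrow> qmod" where "dy = map_poly pderiv"
definition dz :: "qmod \<Rightarrow> qmod" where "dz = map_poly (map_poly pderiv)"

fun curl :: "qmod \<times> qmod \<times> qmod \<Rightarrow> qmod \<times> qmod \<times> qmod"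
  where "curl (p, q, r) = (dy r - dz q, dz p - dx r, dx q - dy p)"

definition grad :: "qmod \<Rightarrow> qmod \<times> qmod \<times> qmod"
  where "grad k = (dx k, dy k, dz k)"

fun cross :: "qmod \<times> qmod \<times> qmod \<Rightarrow> qmod \<times> qmod \<times> qmod \<Rightarrow> qmod \<times> qmod \<times> qmod"
  where "cross (a1, a2, a3) (b1, b2, b3) = (a2 * b3 - a3 * b2, a3 * b1 - a1 * b3, a1 * b2 - a2 * b1)"

definition unimodular :: "(qmod \<Rightarrow> qmod \<Rightarrow> qmod) \<Rightarrow> bool"
  where "unimodular b \<longleftrightarrow>
    (let p = b E4 E6; q = b E6 E2; r = b E2 E4 in
      \<exists>k. curl (p, q, r) = cross (p, q, r) (grad k))"


definition algebra_iso :: "(qmod \<Rightarrow> qmod) \<Rightarrow> bool"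
  where "algebra_iso \<phi> \<longleftrightarrow>
    bij \<phi> \<and> \<phi> 1 = 1 \<and>
    (\<forall>f g. \<phi> (f + g) = \<phi> f + \<phi> g) \<and>
    (\<forall>f g. \<phi> (f * g) = \<phi> f * \<phi> g) \<and>
    (\<forall>c f. \<phi> (const c * f) = const c * \<phi> f)"

definition poisson_modular_isomorphic :: "(qmod \<Rightarrow> qmod \<Rightarrow> qmod) \<Rightarrow> (qmod \<Rightarrow> qmod \<Rightarrow> qmod) \<Rightarrow> bool"
  where "poisson_modular_isomorphic b1 b2 \<longleftrightarrow>
    (\<exists>\<phi>. algebra_iso \<phi> \<and> (\<forall>f g. \<phi> (b1 f g) = b2 (\<phi> f) (\<phi> g)) \<and>
         \<phi> ` modular_algebra \<subseteq> modular_algebra)"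

definition poisson_center :: "(qmod \<Rightarrow> qmod \<Rightarrow> qmod) \<Rightarrow> qmod set"
  where "poisson_center b = {g. \<forall>f. b f g = 0}"

end

theory Submission
  imports Defs "HOL-Real_Asymp.Real_Asymp"
begin

text \<open>
  For forms of weights \<open>k, l\<close> the Euler identity turns the Rankin-Cohen bracket into the Jacobian with
  respect to \<open>E4, E6\<close> times \<open>4 E4 D E6 - 6 E6 D E4\<close>, so the only analytic input is that the latter equals
  \<open>-2 \<Delta>\<close>. This follows from Ramanujan's equations \<open>3 D E4 = E2 E4 - E6\<close> and \<open>2 D E6 = E2 E6 - E4\<^sup>2\<close>,
  which amount to evaluations of the convolution sums \<open>\<sigma>\<^sub>1 * \<sigma>\<^sub>3\<close>, \<open>\<sigma>\<^sub>1 * \<sigma>\<^sub>5\<close> and \<open>\<sigma>\<^sub>3 * \<sigma>\<^sub>3\<close>. These come from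
  a Liouville-type identity: the sum of a suitable combination of values of an even function \<open>f\<close> over all
  positive solutions of \<open>a x + b y = n\<close> collapses to the solutions with \<open>a = b\<close> or \<open>x = y\<close>.

  On the polynomial algebra, a bracket with components \<open>p, q, r\<close> satisfies the Jacobi identity as soon as
  \<open>(p, q, r)\<close> is orthogonal to its curl. Rescaling \<open>E2\<close> by \<open>\<lambda> / \<mu>\<close> identifies the brackets for \<open>\<lambda>\<close> and
  \<open>\<mu>\<close>. A central element is annihilated by the weight derivation, and hence constant.
\<close>

section \<open>Convolution sums of divisor functions\<close>

text \<open>A solution is a splitting n = m + (n - m) with a divisor \<open>a\<close> of m and a
  divisor \<open>b\<close> of n - m; \<open>x\<close> and \<open>y\<close> are the cofactors.
  Integers allow the substitutions to subtract and summands to take negative arguments.\<close>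

definition quads :: "int \<Rightarrow> (int \<times> int \<times> int \<times> int) set" where
  "quads n = {(a, b, x, y). a > 0 \<and> b > 0 \<and> x > 0 \<and> y > 0 \<and> a * x + b * y = n}"

definition quad_sum ::
    "int \<Rightarrow> (int \<Rightarrow> int \<Rightarrow> int \<Rightarrow> int \<Rightarrow> bool) \<Rightarrow> (int \<Rightarrow> int \<Rightarrow> 'a) \<Rightarrow> 'a::comm_ring_1" where
  "quad_sum n P g = (\<Sum>(a, b, x, y) \<in> {(a, b, x, y) \<in> quads n. P a b x y}. g a b)"

abbreviation full_sum :: "int \<Rightarrow> (int \<Rightarrow> int \<Rightarrow> 'a) \<Rightarrow> 'a::comm_ring_1" where
  "full_sum n \<equiv> quad_sum n (\<lambda>_ _ _ _. True)"

lemma finite_quads: "finite (quads n)"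
proof (rule finite_subset)
  show "quads n \<subseteq> {0..n} \<times> {0..n} \<times> {0..n} \<times> {0..n}"
  proof (clarsimp simp: quads_def)
    fix a b x y :: int
    assume h: "0 < a" "0 < b" "0 < x" "0 < y"
    have "a * 1 \<le> a * x" "1 * x \<le> a * x" "b * 1 \<le> b * y" "1 * y \<le> b * y"
      using h by (intro mult_mono; simp)+
    moreover have "0 < a * x" "0 < b * y" using h by auto
    ultimately show "a \<le> a * x + b * y \<and> b \<le> a * x + b * y \<and> x \<le> a * x + b * y \<and> y \<le> a * x + b * y"
      by linarith
  qed
qed auto

lemma finite_quads_filter: "finite {(a, b, x, y) \<in> quads n. P a b x y}"
  by (rule finite_subset[OF _ finite_quads]) auto

lemma quad_sum_add: "quad_sum n P (\<lambda>a b. f a b + g a b) = quad_sum n P f + quad_sum n P g"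
  by (simp add: quad_sum_def sum.distrib case_prod_unfold)

lemma quad_sum_diff: "quad_sum n P (\<lambda>a b. f a b - g a b) = quad_sum n P f - quad_sum n P g"
  by (simp add: quad_sum_def sum_subtractf case_prod_unfold)

lemma quad_sum_cmult: "quad_sum n P (\<lambda>a b. c * f a b) = c * quad_sum n P f"
  by (simp add: quad_sum_def sum_distrib_left case_prod_unfold)

lemma quad_sum_cong:
  assumes "\<And>a b x y. a > 0 \<Longrightarrow> b > 0 \<Longrightarrow> x > 0 \<Longrightarrow> y > 0 \<Longrightarrow> P a b x y \<Longrightarrow> f a b = g a b"
  shows "quad_sum n P f = quad_sum n P g"
  unfolding quad_sum_def by (rule sum.cong) (auto simp: quads_def assms)

lemma quad_sum_disj:
  assumes "\<And>a b x y. \<not> (P a b x y \<and> Q a b x y)"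
  shows "quad_sum n (\<lambda>a b x y. P a b x y \<or> Q a b x y) g = quad_sum n P g + quad_sum n Q g"
proof -
  have *: "{(a, b, x, y) \<in> quads n. P a b x y \<or> Q a b x y} =
      {(a, b, x, y) \<in> quads n. P a b x y} \<union> {(a, b, x, y) \<in> quads n. Q a b x y}"
    by auto
  show ?thesis
    unfolding quad_sum_def *
    by (rule sum.union_disjoint) (use assms finite_quads_filter in auto)
qed

lemma full_sum_split_ab:
  "full_sum n g =
    quad_sum n (\<lambda>a b _ _. b < a) g + quad_sum n (\<lambda>a b _ _. a < b) g + quad_sum n (\<lambda>a b _ _. a = b) g"
    (is "_ = ?rhs")
proof -
  have "full_sum n g = quad_sum n (\<lambda>a b x y. (b < a \<or> a < b) \<or> a = b) g"
    unfolding quad_sum_def by (rule sum.cong) auto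
  also have "\<dots> = ?rhs"
    by (subst quad_sum_disj, force)+ simp
  finally show ?thesis .
qed

lemma full_sum_split_xy:
  "full_sum n g =
    quad_sum n (\<lambda>_ _ x y. x < y) g + quad_sum n (\<lambda>_ _ x y. y < x) g + quad_sum n (\<lambda>_ _ x y. x = y) g"
    (is "_ = ?rhs")
proof -
  have "full_sum n g = quad_sum n (\<lambda>a b x y. (x < y \<or> y < x) \<or> x = y) g"
    unfolding quad_sum_def by (rule sum.cong) auto
  also have "\<dots> = ?rhs"
    by (subst quad_sum_disj, force)+ simp
  finally show ?thesis .
qed

lemma quad_sum_swap: "quad_sum n P g = quad_sum n (\<lambda>a b x y. P b a y x) (\<lambda>a b. g b a)"
  unfolding quad_sum_def
  by (rule sum.reindex_bij_witness[of _ "\<lambda>(a, b, x, y). (b, a, y, x)" "\<lambda>(a, b, x, y). (b, a, y, x)"])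
     (auto simp: quads_def algebra_simps)

text \<open>The single substitution behind all convolution identities: \<open>a x + b y = (a - b) x + b (x + y)\<close>.\<close>

lemma quad_sum_shift_left:
  "quad_sum n (\<lambda>a b _ _. b < a) g = quad_sum n (\<lambda>_ _ x y. x < y) (\<lambda>a b. g (a + b) b)"
  unfolding quad_sum_def
  by (rule sum.reindex_bij_witness[of _ "\<lambda>(a, b, x, y). (a + b, b, x, y - x)"
        "\<lambda>(a, b, x, y). (a - b, b, x, x + y)"])
     (auto simp: quads_def algebra_simps)

lemma quad_sum_shift_right:
  "quad_sum n (\<lambda>a b _ _. a < b) g = quad_sum n (\<lambda>_ _ x y. y < x) (\<lambda>a b. g a (a + b))"
  by (subst (1 2) quad_sum_swap) (simp add: quad_sum_shift_left add.commute)

text \<open>The sums with \<open>f a b\<close>, \<open>f a (a - b)\<close> and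
  \<open>f (b - a) b\<close> are split by comparing \<open>a\<close> with \<open>b\<close> and then
  shifted, the other three by comparing \<open>x\<close> with \<open>y\<close>. Up to swap and
  evenness the open regions then carry the same summands and cancel; only the diagonals
  remain.\<close>

lemma liouville_identity:
  fixes f :: "int \<Rightarrow> int \<Rightarrow> 'a::comm_ring_1"
  assumes even: "\<And>a b. f (- a) (- b) = f a b"
  shows "full_sum n (\<lambda>a b. f a b - f a (- b) + f a (a - b) - f a (a + b) + f (b - a) b - f (a + b) b) =
    quad_sum n (\<lambda>a b _ _. a = b) (\<lambda>a b. f a b + f a 0 + f 0 b) -
    quad_sum n (\<lambda>_ _ x y. x = y) (\<lambda>a b. f a (- b) + f a (a + b) + f (a + b) b)"
proof -
  define U where "U g = quad_sum n (\<lambda>_ _ x y. x < y) g" for g :: "int \<Rightarrow> int \<Rightarrow> 'a"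
  define V where "V g = quad_sum n (\<lambda>_ _ x y. y < x) g" for g :: "int \<Rightarrow> int \<Rightarrow> 'a"
  define X where "X g = quad_sum n (\<lambda>_ _ x y. x = y) g" for g :: "int \<Rightarrow> int \<Rightarrow> 'a"
  define Y where "Y g = quad_sum n (\<lambda>a b _ _. a = b) g" for g :: "int \<Rightarrow> int \<Rightarrow> 'a"
  have 1: "full_sum n g = U g + V g + X g" for g :: "int \<Rightarrow> int \<Rightarrow> 'a"
    unfolding U_def V_def X_def by (rule full_sum_split_xy)
  have 2: "full_sum n g = U (\<lambda>a b. g (a + b) b) + V (\<lambda>a b. g a (a + b)) + Y g"
    for g :: "int \<Rightarrow> int \<Rightarrow> 'a"
    unfolding U_def V_def Y_def
    by (simp add: full_sum_split_ab[of n g] quad_sum_shift_left quad_sum_shift_right)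
  have swap: "U g = V (\<lambda>a b. g b a)" for g :: "int \<Rightarrow> int \<Rightarrow> 'a"
    unfolding U_def V_def by (subst quad_sum_swap) simp
  have neg: "f (- a) b = f a (- b)" for a b
    using even[of a "- b"] by simp
  have e1: "full_sum n f = U (\<lambda>a b. f (a + b) b) + V (\<lambda>a b. f a (a + b)) + Y f"
    by (rule 2)
  \<comment> \<open>The shift turns \<open>f a (a - b)\<close> into \<open>f (a + b) a\<close> on x
    < y and \<open>f a (- b)\<close> on y < x; the swap moves the first summand to y < x.\<close>
  have e2: "full_sum n (\<lambda>a b. f a (a - b)) =
      V (\<lambda>a b. f (a + b) b) + V (\<lambda>a b. f a (- b)) + Y (\<lambda>a b. f a 0)"
    by (subst 2) (auto simp: swap Y_def add.commute intro: quad_sum_cong)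
  have e3: "full_sum n (\<lambda>a b. f (b - a) b) =
      U (\<lambda>a b. f a (- b)) + U (\<lambda>a b. f a (a + b)) + Y (\<lambda>a b. f 0 b)"
    by (subst 2) (auto simp: neg swap Y_def add.commute intro: quad_sum_cong)
  show ?thesis
    unfolding quad_sum_add quad_sum_diff e1 e2 e3
    unfolding 1[of "\<lambda>a b. f a (- b)"] 1[of "\<lambda>a b. f a (a + b)"] 1[of "\<lambda>a b. f (a + b) b"]
    by (simp add: X_def Y_def)
qed

text \<open>With a = b = d the equation reads d (x + y) = n, so d divides n and \<open>x\<close>
  runs from 1 to n / d - 1.\<close>

lemma quad_sum_diag_ab:
  assumes "n > 0"
  shows "quad_sum (int n) (\<lambda>a b _ _. a = b) g =
    (\<Sum>d | d dvd n. (of_nat (n div d) - 1) * g (int d) (int d))"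
proof -
  let ?i = "\<lambda>(d, x). (int d, int d, int x, int (n div d) - int x)"
  let ?j = "\<lambda>(a, b, x, y). (nat a, nat x)"
  have "quad_sum (int n) (\<lambda>a b _ _. a = b) g =
      (\<Sum>(d, x) \<in> (SIGMA d:{d. d dvd n}. {1..<n div d}). g (int d) (int d))"
    unfolding quad_sum_def
  proof (rule sum.reindex_bij_witness[of _ ?i ?j])
    fix q
    assume "q \<in> {(a, b, x, y) \<in> quads (int n). a = b}"
    then obtain b x y where q: "q = (b, b, x, y)" and "(b, b, x, y) \<in> quads (int n)"
      by auto
    then have h: "0 < b" "0 < x" "0 < y" "int n = int (nat b * nat (x + y))"
      by (auto simp: quads_def algebra_simps)
    then have e: "n = nat b * nat (x + y)" by linarith
    then have "n div nat b = nat (x + y)" using h(1)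
      by (metis nonzero_mult_div_cancel_left zero_less_nat_eq less_numeral_extra(3))
    then show "?i (?j q) = q" "?j q \<in> (SIGMA d:{d. d dvd n}. {1..<n div d})"
      "(\<lambda>(d, x). g (int d) (int d)) (?j q) = (\<lambda>(a, b, x, y). g a b) q"
      unfolding q using h(1-3) e by auto
  next
    fix q
    assume "q \<in> (SIGMA d:{d. d dvd n}. {1..<n div d})"
    then obtain d x where q: "q = (d, x)" and h: "d dvd n" "x \<in> {1..<n div d}"
      by auto
    then obtain e where "n = d * e" by auto
    with h assms show "?j (?i q) = q" "?i q \<in> {(a, b, x, y) \<in> quads (int n). a = b}"
      unfolding q by (auto simp: quads_def algebra_simps)
  qed
  also have "\<dots> = (\<Sum>d | d dvd n. \<Sum>x\<in>{1..<n div d}. g (int d) (int d))"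
    using assms by (subst sum.Sigma) auto
  also have "\<dots> = (\<Sum>d | d dvd n. (of_nat (n div d) - 1) * g (int d) (int d))"
  proof (rule sum.cong)
    fix d assume "d \<in> {d. d dvd n}"
    then have "n div d \<ge> 1" using assms by (auto simp: Suc_le_eq dvd_imp_le div_greater_zero_iff intro: Nat.gr0I)
    then show "(\<Sum>x\<in>{1..<n div d}. g (int d) (int d)) = (of_nat (n div d) - 1) * g (int d) (int d)"
      by (simp add: of_nat_diff)
  qed simp
  finally show ?thesis .
qed

text \<open>With x = y the equation reads (a + b) x = n, so d = a + b divides n and \<open>a\<close>
  runs from 1 to d - 1.\<close>

lemma quad_sum_diag_xy:
  assumes "n > 0"
  shows "quad_sum (int n) (\<lambda>_ _ x y. x = y) g =
    (\<Sum>d | d dvd n. \<Sum>a = 1..<d. g (int a) (int d - int a))"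
proof -
  let ?i = "\<lambda>(d, a). (int a, int d - int a, int (n div d), int (n div d))"
  let ?j = "\<lambda>(a, b, x, y). (nat (a + b), nat a)"
  have "quad_sum (int n) (\<lambda>_ _ x y. x = y) g =
      (\<Sum>(d, a) \<in> (SIGMA d:{d. d dvd n}. {1..<d}). g (int a) (int d - int a))"
    unfolding quad_sum_def
  proof (rule sum.reindex_bij_witness[of _ ?i ?j])
    fix q
    assume "q \<in> {(a, b, x, y) \<in> quads (int n). x = y}"
    then obtain a b y where q: "q = (a, b, y, y)" and "(a, b, y, y) \<in> quads (int n)"
      by auto
    then have h: "0 < a" "0 < b" "0 < y" "int n = int (nat (a + b) * nat y)"
      by (auto simp: quads_def algebra_simps)
    then have e: "n = nat (a + b) * nat y" by linarith
    then have "n div nat (a + b) = nat y" using h(1,2)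
      by (metis add_pos_pos nonzero_mult_div_cancel_left zero_less_nat_eq less_numeral_extra(3))
    then show "?i (?j q) = q" "?j q \<in> (SIGMA d:{d. d dvd n}. {1..<d})"
      "(\<lambda>(d, a). g (int a) (int d - int a)) (?j q) = (\<lambda>(a, b, x, y). g a b) q"
      unfolding q using h(1-3) e by auto
  next
    fix q
    assume "q \<in> (SIGMA d:{d. d dvd n}. {1..<d})"
    then obtain d a where q: "q = (d, a)" and h: "d dvd n" "a \<in> {1..<d}"
      by auto
    then obtain e where "n = d * e" by auto
    with h assms show "?j (?i q) = q" "?i q \<in> {(a, b, x, y) \<in> quads (int n). x = y}"
      unfolding q by (auto simp: quads_def algebra_simps)
  qed
  also have "\<dots> = (\<Sum>d | d dvd n. \<Sum>a = 1..<d. g (int a) (int d - int a))"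
    using assms by (subst sum.Sigma) auto
  finally show ?thesis .
qed

text \<open>Group the solutions by m = a x; then \<open>a\<close> and \<open>b\<close> range
  independently over the divisors of m and n - m.\<close>

lemma full_sum_eq_convolution:
  "full_sum (int n) (\<lambda>a b. of_int a ^ i * of_int b ^ j :: 'a::comm_ring_1) =
    (\<Sum>m = 1..<n. of_nat (divisor_sum i m) * of_nat (divisor_sum j (n - m)))"
proof -
  let ?i = "\<lambda>(m, a, b). (int a, int b, int (m div a), int ((n - m) div b))"
  let ?j = "\<lambda>(a, b, x, y). (nat (a * x), nat a, nat b)"
  have "full_sum (int n) (\<lambda>a b. of_int a ^ i * of_int b ^ j :: 'a) =
      (\<Sum>(m, a, b) \<in> (SIGMA m:{1..<n}. {a. a dvd m} \<times> {b. b dvd n - m}). of_nat (a ^ i) * of_nat (b ^ j))"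
    unfolding quad_sum_def
  proof (rule sum.reindex_bij_witness[of _ ?i ?j])
    fix q
    assume "q \<in> {(a, b, x, y) \<in> quads (int n). True}"
    then obtain a b x y where q: "q = (a, b, x, y)"
      and h: "0 < a" "0 < b" "0 < x" "0 < y" "a * x + b * y = int n"
      by (auto simp: quads_def)
    define m where "m = nat a * nat x"
    have m: "nat (a * x) = m" using h by (simp add: m_def nat_mult_distrib)
    have "int n = int (m + nat b * nat y)" using h by (simp add: m_def)
    then have n: "n = m + nat b * nat y" by linarith
    have "m > 0" "nat b * nat y > 0" using h by (auto simp: m_def)
    then show "?i (?j q) = q" "?j q \<in> (SIGMA m:{1..<n}. {a. a dvd m} \<times> {b. b dvd n - m})"
      "(\<lambda>(m, a, b). of_nat (a ^ i) * of_nat (b ^ j)) (?j q) =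
        (\<lambda>(a, b, x, y). of_int a ^ i * of_int b ^ j :: 'a) q"
      unfolding q using h n by (auto simp: m m_def)
  next
    fix q
    assume "q \<in> (SIGMA m:{1..<n}. {a. a dvd m} \<times> {b. b dvd n - m})"
    then obtain m a b where q: "q = (m, a, b)" and h: "m \<in> {1..<n}" "a dvd m" "b dvd n - m"
      by auto
    obtain k l where kl: "m = a * k" "n - m = b * l" using h(2,3) unfolding dvd_def by blast
    then have n: "n = a * k + b * l" using h by auto
    have "a * k > 0" "b * l > 0" unfolding kl[symmetric] using h(1) by auto
    then show "?j (?i q) = q" "?i q \<in> {(a, b, x, y) \<in> quads (int n). True}"
      unfolding q using kl n by (auto simp: quads_def simp flip: of_nat_mult)
  qed
  also have "\<dots> = (\<Sum>m = 1..<n. \<Sum>(a, b) \<in> {a. a dvd m} \<times> {b. b dvd n - m}. of_nat (a ^ i) * of_nat (b ^ j))"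
    by (subst sum.Sigma) auto
  also have "\<dots> = (\<Sum>m = 1..<n. of_nat (divisor_sum i m) * of_nat (divisor_sum j (n - m)))"
    by (simp add: divisor_sum_def sum_product sum.cartesian_product)
  finally show ?thesis .
qed

section \<open>Power sums and the evaluation of the convolution sums\<close>

lemma power_sums:
  fixes d :: nat
  shows "(\<Sum>a = 1..<d. of_nat a :: 'a::field_char_0) = of_nat d ^ 2 / 2 - of_nat d / 2"
    and "(\<Sum>a = 1..<d. of_nat a ^ 2 :: 'a) = of_nat d ^ 3 / 3 - of_nat d ^ 2 / 2 + of_nat d / 6"
    and "(\<Sum>a = 1..<d. of_nat a ^ 3 :: 'a) = of_nat d ^ 4 / 4 - of_nat d ^ 3 / 2 + of_nat d ^ 2 / 4"
    and "(\<Sum>a = 1..<d. of_nat a ^ 4 :: 'a) =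
      of_nat d ^ 5 / 5 - of_nat d ^ 4 / 2 + of_nat d ^ 3 / 3 - of_nat d / 30"
    and "(\<Sum>a = 1..<d. of_nat a ^ 5 :: 'a) =
      of_nat d ^ 6 / 6 - of_nat d ^ 5 / 2 + 5 * of_nat d ^ 4 / 12 - of_nat d ^ 2 / 12"
    and "(\<Sum>a = 1..<d. of_nat a ^ 6 :: 'a) =
      of_nat d ^ 7 / 7 - of_nat d ^ 6 / 2 + of_nat d ^ 5 / 2 - of_nat d ^ 3 / 6 + of_nat d / 42"
proof (induction d)
  case (Suc d)
  \<comment> \<open>For \<open>d = 0\<close> the interval \<open>1..<Suc d\<close> is empty, so the
    term \<open>f d\<close> can be split off only for positive \<open>d\<close>.\<close>
  have ivl: "(\<Sum>a = 1..<Suc d. f a) = (\<Sum>a = 1..<d. f a) + f d" if "d \<noteq> 0" for f :: "nat \<Rightarrow> 'a"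
    using that by simp
  {
    case 1
    show ?case
    proof (cases "d = 0")
      case False
      show ?thesis
        unfolding ivl[OF False] Suc(1) by (simp add: field_simps eval_nat_numeral)
    qed simp
  }
  {
    case 2
    show ?case
    proof (cases "d = 0")
      case False
      show ?thesis
        unfolding ivl[OF False] Suc(2) by (simp add: field_simps eval_nat_numeral)
    qed simp
  }
  {
    case 3
    show ?case
    proof (cases "d = 0")
      case False
      show ?thesis
        unfolding ivl[OF False] Suc(3) by (simp add: field_simps eval_nat_numeral)
    qed simp
  }
  {
    case 4
    show ?case
    proof (cases "d = 0")
      case False
      show ?thesis
        unfolding ivl[OF False] Suc(4) by (simp add: field_simps eval_nat_numeral)
    qed simp
  }
  {
    case 5
    show ?case
    proof (cases "d = 0")
      case False
      show ?thesis
        unfolding ivl[OF False] Suc(5) by (simp add: field_simps eval_nat_numeral)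
    qed simp
  }
  {
    case 6
    show ?case
    proof (cases "d = 0")
      case False
      show ?thesis
        unfolding ivl[OF False] Suc(6) by (simp add: field_simps eval_nat_numeral)
    qed simp
  }
qed simp_all

text \<open>Since d (n / d) = n, each summand equals n d^k - d^(k+1).\<close>

lemma sum_divisors_cofactor:
  assumes "n > 0"
  shows "(\<Sum>d | d dvd n. (of_nat (n div d) - 1) * of_nat d ^ Suc k) =
    (of_nat n * of_nat (divisor_sum k n) - of_nat (divisor_sum (Suc k) n) :: 'a::comm_ring_1)"
proof -
  have "(of_nat (n div d) - 1) * of_nat d ^ Suc k = of_nat n * of_nat d ^ k - (of_nat d ^ Suc k :: 'a)"
    if "d \<in> {d. d dvd n}" for d
  proof -
    have "of_nat n = (of_nat (n div d) * of_nat d :: 'a)"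
      using that by (metis dvd_div_mult_self mem_Collect_eq of_nat_mult)
    then show ?thesis by (simp add: algebra_simps)
  qed
  then have "(\<Sum>d | d dvd n. (of_nat (n div d) - 1) * of_nat d ^ Suc k) =
      (\<Sum>d | d dvd n. of_nat n * of_nat d ^ k - (of_nat d ^ Suc k :: 'a))"
    by (rule sum.cong[OF refl])
  then show ?thesis
    by (simp add: divisor_sum_def sum_subtractf sum_distrib_left)
qed

definition sigma_conv :: "nat \<Rightarrow> nat \<Rightarrow> nat \<Rightarrow> complex" where
  "sigma_conv n i j = (\<Sum>m = 1..<n. of_nat (divisor_sum i m) * of_nat (divisor_sum j (n - m)))"

lemma sigma_conv_eq: "sigma_conv n i j = full_sum (int n) (\<lambda>a b. of_int a ^ i * of_int b ^ j)"
  by (simp add: sigma_conv_def full_sum_eq_convolution)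

lemma sigma_conv_commute: "sigma_conv n i j = sigma_conv n j i"
  unfolding sigma_conv_eq by (subst quad_sum_swap) (simp add: mult.commute)

context
  fixes n :: nat
  assumes n: "n > 0"
begin

abbreviation "\<sigma> k \<equiv> of_nat (divisor_sum k n) :: complex"

text \<open>Liouville's identity prepared for monomials \<open>f\<close> of degree
  \<open>Suc k\<close>. On the diagonal x = y one has b = d - a, so the inner sum over
  \<open>a\<close> is a polynomial \<open>G\<close> in d.\<close>

lemma liouville_divisor_form:
  fixes f :: "int \<Rightarrow> int \<Rightarrow> complex"
  assumes "\<And>a b. f (- a) (- b) = f a b"
    and "\<And>a b. f a b - f a (- b) + f a (a - b) - f a (a + b) + f (b - a) b - f (a + b) b = g a b"
    and "\<And>a. f a a + f a 0 + f 0 a = of_int a ^ Suc k"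
    and "\<And>d. (\<Sum>a = 1..<d. f (int a) (int a - int d) + f (int a) (int d) + f (int d) (int d - int a)) = G d"
  shows "full_sum (int n) g = of_nat n * \<sigma> k - \<sigma> (Suc k) - (\<Sum>d | d dvd n. G d)"
proof -
  have "full_sum (int n) g =
      quad_sum n (\<lambda>a b _ _. a = b) (\<lambda>a b. f a b + f a 0 + f 0 b) -
      quad_sum n (\<lambda>_ _ x y. x = y) (\<lambda>a b. f a (- b) + f a (a + b) + f (a + b) b)"
    unfolding liouville_identity[where f = f, OF assms(1), symmetric] assms(2) ..
  also have "quad_sum n (\<lambda>a b _ _. a = b) (\<lambda>a b. f a b + f a 0 + f 0 b) =
      (\<Sum>d | d dvd n. (of_nat (n div d) - 1) * of_nat d ^ Suc k)"
    unfolding quad_sum_diag_ab[OF n] assms(3) by simp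
  also have "\<dots> = of_nat n * \<sigma> k - \<sigma> (Suc k)"
    by (rule sum_divisors_cofactor[OF n])
  also have "quad_sum n (\<lambda>_ _ x y. x = y) (\<lambda>a b. f a (- b) + f a (a + b) + f (a + b) b) =
      (\<Sum>d | d dvd n. G d)"
    unfolding quad_sum_diag_xy[OF n] assms(4)[symmetric] by simp
  finally show ?thesis .
qed

lemma sum_divisors_power:
  "(\<Sum>d | d dvd n. c * of_nat d ^ k) = c * \<sigma> k"
  by (simp add: divisor_sum_def sum_distrib_left)

text \<open>The monomial a^3 b yields -2 a^3 b - 6 a b^3; both terms sum to the same convolution by
  symmetry, which gives the factor -8. The \<sigma> 4 terms of the two diagonals cancel.\<close>

lemma convolution_1_3: "240 * sigma_conv n 1 3 = 21 * \<sigma> 5 + 10 * \<sigma> 3 - 30 * of_nat n * \<sigma> 3 - \<sigma> 1"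
proof -
  \<comment> \<open>The closed form of the sum of a^4 - d^3 a + d^4 over 0 < a < d. The factors
    \<open>1 *\<close> and exponents \<open>^ 1\<close> are kept so that
    \<open>sum_divisors_power\<close> matches every term.\<close>
  let ?G = "\<lambda>d. 7 / 10 * of_nat d ^ 5 - 1 * of_nat d ^ 4 + 1 / 3 * of_nat d ^ 3 - 1 / 30 * of_nat d ^ 1 :: complex"
  have "full_sum (int n) (\<lambda>a b. (-2) * (of_int a ^ 3 * of_int b ^ 1) + (-6) * (of_int a ^ 1 * of_int b ^ 3)) =
      of_nat n * \<sigma> 3 - \<sigma> (Suc 3) - (\<Sum>d | d dvd n. ?G d)"
  proof (rule liouville_divisor_form[where f = "\<lambda>a b. of_int a ^ 3 * of_int b ^ 1"])
    fix d :: nat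
    have "(\<Sum>a = 1..<d. of_int (int a) ^ 3 * of_int (int a - int d) ^ 1 +
          of_int (int a) ^ 3 * of_int (int d) ^ 1 + of_int (int d) ^ 3 * of_int (int d - int a) ^ 1 :: complex) =
        (\<Sum>a = 1..<d. of_nat a ^ 4 - of_nat d ^ 3 * of_nat a + of_nat d ^ 4)"
      by (rule sum.cong) (simp_all add: algebra_simps eval_nat_numeral)
    also have "\<dots> = ?G d"
      unfolding sum.distrib sum_subtractf sum_distrib_left[symmetric] power_sums
      \<comment> \<open>The constant summand occurs \<open>d - 1\<close> times, and this subtraction
        is truncated at \<open>d = 0\<close>.\<close>
      by (cases "d = 0") (simp_all add: of_nat_diff field_simps eval_nat_numeral)
    finally show "(\<Sum>a = 1..<d. of_int (int a) ^ 3 * of_int (int a - int d) ^ 1 +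
          of_int (int a) ^ 3 * of_int (int d) ^ 1 + of_int (int d) ^ 3 * of_int (int d - int a) ^ 1 :: complex) =
        ?G d" .
  qed (simp_all add: algebra_simps eval_nat_numeral)
  then have *: "- 8 * sigma_conv n 1 3 =
      of_nat n * \<sigma> 3 - \<sigma> (Suc 3) - (7 / 10 * \<sigma> 5 - 1 * \<sigma> 4 + 1 / 3 * \<sigma> 3 - 1 / 30 * \<sigma> 1)"
    unfolding quad_sum_add quad_sum_cmult sigma_conv_eq[symmetric] sum.distrib sum_subtractf sum_divisors_power
      sigma_conv_commute[of n 3 1]
    by (simp del: One_nat_def)
  have "240 * sigma_conv n 1 3 = - 30 * (- 8 * sigma_conv n 1 3)" by simp
  then show ?thesis
    unfolding * by (simp add: algebra_simps)
qed

text \<open>The monomials a^5 b and a^3 b^3 give two independent linear equations for the two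
  unknown convolutions.\<close>

lemma convolution_degree_6:
  "12 * sigma_conv n 1 5 + 20 * sigma_conv n 3 3 =
    \<sigma> 6 - of_nat n * \<sigma> 5 + (9 / 14 * \<sigma> 7 - 1 * \<sigma> 6 + 1 / 2 * \<sigma> 5 - 1 / 6 * \<sigma> 3 + 1 / 42 * \<sigma> 1)"
  "12 * sigma_conv n 1 5 + 2 * sigma_conv n 3 3 =
    \<sigma> 6 - of_nat n * \<sigma> 5 + (69 / 140 * \<sigma> 7 - 1 * \<sigma> 6 + 1 / 2 * \<sigma> 5 - 1 / 60 * \<sigma> 3 + 1 / 42 * \<sigma> 1)"
proof -
  let ?G = "\<lambda>d. 9 / 14 * of_nat d ^ 7 - 1 * of_nat d ^ 6 + 1 / 2 * of_nat d ^ 5 - 1 / 6 * of_nat d ^ 3 +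
    1 / 42 * of_nat d ^ 1 :: complex"
  have "full_sum (int n) (\<lambda>a b. (-2) * (of_int a ^ 5 * of_int b ^ 1) +
        (-20) * (of_int a ^ 3 * of_int b ^ 3) + (-10) * (of_int a ^ 1 * of_int b ^ 5)) =
      of_nat n * \<sigma> 5 - \<sigma> (Suc 5) - (\<Sum>d | d dvd n. ?G d)"
  proof (rule liouville_divisor_form[where f = "\<lambda>a b. of_int a ^ 5 * of_int b ^ 1"])
    fix d :: nat
    have "(\<Sum>a = 1..<d. of_int (int a) ^ 5 * of_int (int a - int d) ^ 1 +
          of_int (int a) ^ 5 * of_int (int d) ^ 1 + of_int (int d) ^ 5 * of_int (int d - int a) ^ 1 :: complex) =
        (\<Sum>a = 1..<d. of_nat a ^ 6 - of_nat d ^ 5 * of_nat a + of_nat d ^ 6)"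
      by (rule sum.cong) (simp_all add: algebra_simps eval_nat_numeral)
    also have "\<dots> = ?G d"
      unfolding sum.distrib sum_subtractf sum_distrib_left[symmetric] power_sums
      by (cases "d = 0") (simp_all add: of_nat_diff field_simps eval_nat_numeral)
    finally show "(\<Sum>a = 1..<d. of_int (int a) ^ 5 * of_int (int a - int d) ^ 1 +
          of_int (int a) ^ 5 * of_int (int d) ^ 1 + of_int (int d) ^ 5 * of_int (int d - int a) ^ 1 :: complex) =
        ?G d" .
  qed (simp_all add: algebra_simps eval_nat_numeral)
  then have *: "- 2 * sigma_conv n 1 5 + (- 20) * sigma_conv n 3 3 + (- 10) * sigma_conv n 1 5 =
      of_nat n * \<sigma> 5 - \<sigma> (Suc 5) -
      (9 / 14 * \<sigma> 7 - 1 * \<sigma> 6 + 1 / 2 * \<sigma> 5 - 1 / 6 * \<sigma> 3 + 1 / 42 * \<sigma> 1)"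
    unfolding quad_sum_add quad_sum_cmult sigma_conv_eq[symmetric] sum.distrib sum_subtractf sum_divisors_power
      sigma_conv_commute[of n 5 1] .
  have "12 * sigma_conv n 1 5 + 20 * sigma_conv n 3 3 =
      - (- 2 * sigma_conv n 1 5 + (- 20) * sigma_conv n 3 3 + (- 10) * sigma_conv n 1 5)"
    by simp
  then show "12 * sigma_conv n 1 5 + 20 * sigma_conv n 3 3 =
    \<sigma> 6 - of_nat n * \<sigma> 5 + (9 / 14 * \<sigma> 7 - 1 * \<sigma> 6 + 1 / 2 * \<sigma> 5 - 1 / 6 * \<sigma> 3 + 1 / 42 * \<sigma> 1)"
    unfolding * by simp
next
  let ?G = "\<lambda>d. 69 / 140 * of_nat d ^ 7 - 1 * of_nat d ^ 6 + 1 / 2 * of_nat d ^ 5 - 1 / 60 * of_nat d ^ 3 +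
    1 / 42 * of_nat d ^ 1 :: complex"
  have "full_sum (int n) (\<lambda>a b. (-6) * (of_int a ^ 5 * of_int b ^ 1) +
        (-2) * (of_int a ^ 3 * of_int b ^ 3) + (-6) * (of_int a ^ 1 * of_int b ^ 5)) =
      of_nat n * \<sigma> 5 - \<sigma> (Suc 5) - (\<Sum>d | d dvd n. ?G d)"
  proof (rule liouville_divisor_form[where f = "\<lambda>a b. of_int a ^ 3 * of_int b ^ 3"])
    fix d :: nat
    have "(\<Sum>a = 1..<d. of_int (int a) ^ 3 * of_int (int a - int d) ^ 3 +
          of_int (int a) ^ 3 * of_int (int d) ^ 3 + of_int (int d) ^ 3 * of_int (int d - int a) ^ 3 :: complex) =
        (\<Sum>a = 1..<d. of_nat a ^ 6 - (3 * of_nat d) * of_nat a ^ 5 + (3 * of_nat d ^ 2) * of_nat a ^ 4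
          - of_nat d ^ 3 * of_nat a ^ 3 + (3 * of_nat d ^ 4) * of_nat a ^ 2 - (3 * of_nat d ^ 5) * of_nat a + of_nat d ^ 6)"
      by (rule sum.cong) (simp_all add: algebra_simps eval_nat_numeral)
    also have "\<dots> = ?G d"
      unfolding sum.distrib sum_subtractf sum_distrib_left[symmetric] power_sums
      by (cases "d = 0") (simp_all add: of_nat_diff field_simps eval_nat_numeral)
    finally show "(\<Sum>a = 1..<d. of_int (int a) ^ 3 * of_int (int a - int d) ^ 3 +
          of_int (int a) ^ 3 * of_int (int d) ^ 3 + of_int (int d) ^ 3 * of_int (int d - int a) ^ 3 :: complex) =
        ?G d" .
  qed (simp_all add: algebra_simps eval_nat_numeral)
  then have *: "- 6 * sigma_conv n 1 5 + (- 2) * sigma_conv n 3 3 + (- 6) * sigma_conv n 1 5 =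
      of_nat n * \<sigma> 5 - \<sigma> (Suc 5) -
      (69 / 140 * \<sigma> 7 - 1 * \<sigma> 6 + 1 / 2 * \<sigma> 5 - 1 / 60 * \<sigma> 3 + 1 / 42 * \<sigma> 1)"
    unfolding quad_sum_add quad_sum_cmult sigma_conv_eq[symmetric] sum.distrib sum_subtractf sum_divisors_power
      sigma_conv_commute[of n 5 1] .
  have "12 * sigma_conv n 1 5 + 2 * sigma_conv n 3 3 =
      - (- 6 * sigma_conv n 1 5 + (- 2) * sigma_conv n 3 3 + (- 6) * sigma_conv n 1 5)"
    by simp
  then show "12 * sigma_conv n 1 5 + 2 * sigma_conv n 3 3 =
    \<sigma> 6 - of_nat n * \<sigma> 5 + (69 / 140 * \<sigma> 7 - 1 * \<sigma> 6 + 1 / 2 * \<sigma> 5 - 1 / 60 * \<sigma> 3 + 1 / 42 * \<sigma> 1)"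
    unfolding * by simp
qed

text \<open>Subtracting the two equations eliminates \<open>sigma_conv n 1 5\<close> together with
  the terms in n \<sigma> 5, \<sigma> 5 and \<sigma> 6. The result is E4^2 = E8 in terms of
  coefficients.\<close>

lemma convolution_3_3: "120 * sigma_conv n 3 3 = \<sigma> 7 - \<sigma> 3"
proof -
  have "120 * sigma_conv n 3 3 =
      20 / 3 * ((12 * sigma_conv n 1 5 + 20 * sigma_conv n 3 3) -
        (12 * sigma_conv n 1 5 + 2 * sigma_conv n 3 3))"
    by simp
  then show ?thesis
    unfolding convolution_degree_6 by (simp add: algebra_simps)
qed

lemma convolution_1_5: "504 * sigma_conv n 1 5 = 20 * \<sigma> 7 - 42 * of_nat n * \<sigma> 5 + 21 * \<sigma> 5 + \<sigma> 1"
proof -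
  have "504 * sigma_conv n 1 5 = 42 * (12 * sigma_conv n 1 5 + 2 * sigma_conv n 3 3) - 7 / 10 * (120 * sigma_conv n 3 3)"
    by simp
  then show ?thesis
    unfolding convolution_degree_6(2) convolution_3_3 by (simp add: algebra_simps)
qed

end

section \<open>Differential equations of the Eisenstein series\<close>

definition sigma_fps :: "nat \<Rightarrow> complex fps" where
  "sigma_fps k = Abs_fps (\<lambda>n. of_nat (divisor_sum k n))"

text \<open>The set of divisors of \<open>0\<close> is infinite, so its sum is the junk value \<open>0\<close>, which is
  just what makes the series start at \<open>n = 1\<close>.\<close>

lemma divisor_sum_0 [simp]: "divisor_sum k 0 = 0"
  by (simp add: divisor_sum_def)

lemma sigma_fps_nth [simp]: "fps_nth (sigma_fps k) n = of_nat (divisor_sum k n)"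
  by (simp add: sigma_fps_def)

text \<open>The end terms m = 0 and m = n of the Cauchy product vanish by
  \<open>divisor_sum_0\<close>.\<close>

lemma sigma_fps_mult_nth: "fps_nth (sigma_fps i * sigma_fps j) n = sigma_conv n i j"
proof (cases "n = 0")
  case False
  then have "{0..n} = {0, n} \<union> {1..<n}" by auto
  then have "fps_nth (sigma_fps i * sigma_fps j) n =
      (\<Sum>m \<in> {0, n} \<union> {1..<n}. of_nat (divisor_sum i m) * of_nat (divisor_sum j (n - m)))"
    by (simp add: fps_mult_nth)
  also have "\<dots> = sigma_conv n i j"
    unfolding sigma_conv_def by (rule sum.mono_neutral_right) auto
  finally show ?thesis .
qed (simp add: sigma_conv_def)

text \<open>The operator q d/dq, which corresponds to \<open>D\<close> under q =
  \<open>nome \<tau>\<close>.\<close>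

abbreviation q_deriv :: "complex fps \<Rightarrow> complex fps" where
  "q_deriv f \<equiv> fps_X * fps_deriv f"

lemma q_deriv_nth: "fps_nth (q_deriv f) n = of_nat n * fps_nth f n"
  by (cases n) simp_all

lemma sigma_fps_convolutions:
  "240 * (sigma_fps 1 * sigma_fps 3) =
    21 * sigma_fps 5 + 10 * sigma_fps 3 - 30 * q_deriv (sigma_fps 3) - sigma_fps 1"
  "120 * (sigma_fps 3 * sigma_fps 3) = sigma_fps 7 - sigma_fps 3"
  "504 * (sigma_fps 1 * sigma_fps 5) =
    20 * sigma_fps 7 - 42 * q_deriv (sigma_fps 5) + 21 * sigma_fps 5 + sigma_fps 1"
proof -
  \<comment> \<open>The convolution formulas assume n > 0; the constant coefficients are compared
    separately and all vanish.\<close>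
  have 0: "sigma_conv 0 i j = 0" for i j by (simp add: sigma_conv_def)
  show "240 * (sigma_fps 1 * sigma_fps 3) =
    21 * sigma_fps 5 + 10 * sigma_fps 3 - 30 * q_deriv (sigma_fps 3) - sigma_fps 1"
  proof (rule fps_ext)
    fix n
    show "fps_nth (240 * (sigma_fps 1 * sigma_fps 3)) n =
      fps_nth (21 * sigma_fps 5 + 10 * sigma_fps 3 - 30 * q_deriv (sigma_fps 3) - sigma_fps 1) n"
      unfolding numeral_fps_const fps_add_nth fps_sub_nth fps_mult_left_const_nth q_deriv_nth
        sigma_fps_mult_nth sigma_fps_nth
      using convolution_1_3[of n] by (cases "n = 0") (simp_all add: 0)
  qed
  show "120 * (sigma_fps 3 * sigma_fps 3) = sigma_fps 7 - sigma_fps 3"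
  proof (rule fps_ext)
    fix n
    show "fps_nth (120 * (sigma_fps 3 * sigma_fps 3)) n = fps_nth (sigma_fps 7 - sigma_fps 3) n"
      unfolding numeral_fps_const fps_add_nth fps_sub_nth fps_mult_left_const_nth q_deriv_nth
        sigma_fps_mult_nth sigma_fps_nth
      using convolution_3_3[of n] by (cases "n = 0") (simp_all add: 0)
  qed
  show "504 * (sigma_fps 1 * sigma_fps 5) =
    20 * sigma_fps 7 - 42 * q_deriv (sigma_fps 5) + 21 * sigma_fps 5 + sigma_fps 1"
  proof (rule fps_ext)
    fix n
    show "fps_nth (504 * (sigma_fps 1 * sigma_fps 5)) n =
      fps_nth (20 * sigma_fps 7 - 42 * q_deriv (sigma_fps 5) + 21 * sigma_fps 5 + sigma_fps 1) n"
      unfolding numeral_fps_const fps_add_nth fps_sub_nth fps_mult_left_const_nth q_deriv_nth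
        sigma_fps_mult_nth sigma_fps_nth
      using convolution_1_5[of n] by (cases "n = 0") (simp_all add: 0)
  qed
qed

definition E2_fps :: "complex fps" where "E2_fps = 1 - 24 * sigma_fps 1"
definition E4_fps :: "complex fps" where "E4_fps = 1 + 240 * sigma_fps 3"
definition E6_fps :: "complex fps" where "E6_fps = 1 - 504 * sigma_fps 5"

lemma q_deriv_E4: "3 * q_deriv E4_fps = E2_fps * E4_fps - E6_fps"
proof -
  have "E2_fps * E4_fps - E6_fps =
      504 * sigma_fps 5 + 240 * sigma_fps 3 - 24 * sigma_fps 1 - 24 * (240 * (sigma_fps 1 * sigma_fps 3))"
    by (simp add: E2_fps_def E4_fps_def E6_fps_def algebra_simps)
  also have "\<dots> = 3 * q_deriv E4_fps"
    unfolding sigma_fps_convolutions by (simp add: E4_fps_def algebra_simps)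
  finally show ?thesis ..
qed

lemma q_deriv_E6: "2 * q_deriv E6_fps = E2_fps * E6_fps - E4_fps ^ 2"
proof -
  have "E2_fps * E6_fps - E4_fps ^ 2 =
      24 * (504 * (sigma_fps 1 * sigma_fps 5)) - 24 * sigma_fps 1 - 504 * sigma_fps 5
       - 480 * sigma_fps 3 - 480 * (120 * (sigma_fps 3 * sigma_fps 3))"
    by (simp add: E2_fps_def E4_fps_def E6_fps_def algebra_simps power2_eq_square)
  also have "\<dots> = 2 * q_deriv E6_fps"
    unfolding sigma_fps_convolutions by (simp add: E6_fps_def algebra_simps)
  finally show ?thesis ..
qed

text \<open>By Ramanujan's equations the left side is 2 E4 (E2 E6 - E4^2) - 2 E6 (E2 E4 - E6), where
  the terms with E2 cancel.\<close>

lemma E4_E6_Wronskian: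
  "4 * E4_fps * q_deriv E6_fps - 6 * E6_fps * q_deriv E4_fps = - 2 * (E4_fps ^ 3 - E6_fps ^ 2)"
proof -
  have "4 * E4_fps * q_deriv E6_fps - 6 * E6_fps * q_deriv E4_fps =
      2 * E4_fps * (2 * q_deriv E6_fps) - 2 * E6_fps * (3 * q_deriv E4_fps)"
    by (simp add: algebra_simps)
  also have "\<dots> = - 2 * (E4_fps ^ 3 - E6_fps ^ 2)"
    unfolding q_deriv_E4 q_deriv_E6 by (simp add: algebra_simps power2_eq_square power3_eq_cube)
  finally show ?thesis .
qed

section \<open>Convergence in the unit disc and passage to functions of \<tau>\<close>

lemma divisor_sum_le: "divisor_sum k n \<le> Suc n ^ Suc k"
proof (cases "n = 0")
  case False
  have "divisor_sum k n \<le> (\<Sum>d | d dvd n. Suc n ^ k)"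
    unfolding divisor_sum_def using False by (intro sum_mono power_mono) (auto dest: dvd_imp_le)
  also have "\<dots> \<le> Suc n * Suc n ^ k"
  proof -
    have "{d. d dvd n} \<subseteq> {..n}"
      using False by (auto dest: dvd_imp_le)
    then have "card {d. d dvd n} \<le> Suc n"
      using card_mono[of "{..n}" "{d. d dvd n}"] by simp
    then have "card {d. d dvd n} * Suc n ^ k \<le> Suc n * Suc n ^ k"
      by (rule mult_le_mono1)
    then show ?thesis by simp
  qed
  finally show ?thesis by simp
qed simp

text \<open>The coefficients are dominated by (n + 1)^(k+1), whose consecutive ratios tend to 1. The
  base n + 1 keeps the comparison sequence nonzero for the ratio test.\<close>

lemma conv_radius_sigma_fps: "fps_conv_radius (sigma_fps k) \<ge> 1"
  unfolding fps_conv_radius_def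
proof (rule conv_radius_geI_ex')
  fix r :: real
  assume r: "0 < r" "ereal r < 1"
  have "(\<lambda>n. norm (real (Suc n) ^ Suc k) / norm (real (Suc (Suc n)) ^ Suc k)) \<longlonglongrightarrow> 1"
  proof -
    have "(\<lambda>n. real (Suc n) / real (Suc (Suc n))) \<longlonglongrightarrow> 1"
      by real_asymp
    from tendsto_power[OF this, of "Suc k"] show ?thesis
      by (simp add: power_divide del: power_Suc of_nat_Suc)
  qed
  then have "conv_radius (\<lambda>n. real (Suc n) ^ Suc k) = 1"
    by (intro conv_radius_ratio_limit_nonzero[where c = 1]) (auto simp: one_ereal_def)
  then have "summable (\<lambda>n. norm (real (Suc n) ^ Suc k * r ^ n))"
    using r by (intro abs_summable_in_conv_radius) auto
  then have "summable (\<lambda>n. real (Suc n) ^ Suc k * r ^ n)"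
    using r by simp
  then show "summable (\<lambda>n. fps_nth (sigma_fps k) n * complex_of_real r ^ n)"
  proof (rule summable_comparison_test'[where N = 0])
    fix n
    have "real (divisor_sum k n) \<le> real (Suc n) ^ Suc k"
      unfolding of_nat_power[symmetric] of_nat_le_iff by (rule divisor_sum_le)
    then show "norm (fps_nth (sigma_fps k) n * complex_of_real r ^ n) \<le> real (Suc n) ^ Suc k * r ^ n"
      using r by (simp add: norm_mult norm_power mult_right_mono del: power_Suc of_nat_Suc)
  qed
qed

lemma conv_radius_ge_1_intros:
  fixes f g :: "complex fps"
  shows "fps_conv_radius f \<ge> 1 \<Longrightarrow> fps_conv_radius g \<ge> 1 \<Longrightarrow> fps_conv_radius (f + g) \<ge> 1"
    and "fps_conv_radius f \<ge> 1 \<Longrightarrow> fps_conv_radius g \<ge> 1 \<Longrightarrow> fps_conv_radius (f - g) \<ge> 1"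
    and "fps_conv_radius f \<ge> 1 \<Longrightarrow> fps_conv_radius g \<ge> 1 \<Longrightarrow> fps_conv_radius (f * g) \<ge> 1"
    and "fps_conv_radius f \<ge> 1 \<Longrightarrow> fps_conv_radius (f ^ n) \<ge> 1"
    and "fps_conv_radius f \<ge> 1 \<Longrightarrow> fps_conv_radius (fps_deriv f) \<ge> 1"
  by (meson fps_conv_radius_add fps_conv_radius_diff fps_conv_radius_mult fps_conv_radius_power
      fps_conv_radius_deriv order_trans min.boundedI)+

lemma conv_radius_Eisenstein_fps:
  "fps_conv_radius E4_fps \<ge> 1" "fps_conv_radius E6_fps \<ge> 1" "fps_conv_radius E2_fps \<ge> 1"
  unfolding E2_fps_def E4_fps_def E6_fps_def
  by (intro conv_radius_ge_1_intros conv_radius_sigma_fps; simp)+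

lemma norm_nome: "Im \<tau> > 0 \<Longrightarrow> norm (nome \<tau>) < 1"
  by (simp add: nome_def)

lemma eval_sigma_fps:
  assumes "Im \<tau> > 0"
  shows "(\<Sum>n. of_nat (divisor_sum k (Suc n)) * nome \<tau> ^ Suc n) = eval_fps (sigma_fps k) (nome \<tau>)"
proof -
  have "ereal (norm (nome \<tau>)) < fps_conv_radius (sigma_fps k)"
    using norm_nome[OF assms] conv_radius_sigma_fps[of k] by (meson ereal_less(3) less_le_trans)
  then have "summable (\<lambda>n. fps_nth (sigma_fps k) n * nome \<tau> ^ n)"
    by (rule summable_fps)
  from suminf_split_head[OF this] show ?thesis
    by (simp add: eval_fps_def)
qed

context
  fixes \<tau> :: complex
  assumes \<tau>: "Im \<tau> > 0"
begin

lemma nome_in_disc: "fps_conv_radius f \<ge> 1 \<Longrightarrow> ereal (norm (nome \<tau>)) < fps_conv_radius f"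
  using norm_nome[OF \<tau>] by (meson ereal_less(3) less_le_trans)

lemma E2_fun_eq: "E2_fun \<tau> = eval_fps E2_fps (nome \<tau>)"
  unfolding E2_fun_def eval_sigma_fps[OF \<tau>] E2_fps_def
  \<comment> \<open>Evaluation respects sums and products only inside the discs of convergence, so
    every rewrite leaves conditions on the radii.\<close>
  by (subst eval_fps_diff eval_fps_mult,
      (intro nome_in_disc conv_radius_ge_1_intros conv_radius_sigma_fps; simp)+)+ simp

lemma E4_fun_eq: "E4_fun \<tau> = eval_fps E4_fps (nome \<tau>)"
  unfolding E4_fun_def eval_sigma_fps[OF \<tau>] E4_fps_def
  by (subst eval_fps_add eval_fps_mult,
      (intro nome_in_disc conv_radius_ge_1_intros conv_radius_sigma_fps; simp)+)+ simp

lemma E6_fun_eq: "E6_fun \<tau> = eval_fps E6_fps (nome \<tau>)"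
  unfolding E6_fun_def eval_sigma_fps[OF \<tau>] E6_fps_def
  by (subst eval_fps_diff eval_fps_mult,
      (intro nome_in_disc conv_radius_ge_1_intros conv_radius_sigma_fps; simp)+)+ simp

end

text \<open>The chain rule with nome' = 2 pi i nome. \<open>F\<close> agrees with the series only on
  the upper half-plane, but that set is open, so the derivative carries over.\<close>

lemma has_field_derivative_eval_nome:
  assumes "Im \<tau> > 0" "fps_conv_radius f \<ge> 1"
    and "\<And>\<tau>. Im \<tau> > 0 \<Longrightarrow> F \<tau> = eval_fps f (nome \<tau>)"
  shows "(F has_field_derivative 2 * of_real pi * \<i> * eval_fps (q_deriv f) (nome \<tau>)) (at \<tau>)"
proof -
  have n: "(nome has_field_derivative 2 * of_real pi * \<i> * nome \<tau>) (at \<tau>)"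
    unfolding nome_def[abs_def] by (auto intro!: derivative_eq_intros)
  have e: "eval_fps (q_deriv f) (nome \<tau>) = nome \<tau> * eval_fps (fps_deriv f) (nome \<tau>)"
    using assms by (subst eval_fps_mult) (auto intro!: nome_in_disc conv_radius_ge_1_intros)
  have "((\<lambda>\<tau>. eval_fps f (nome \<tau>)) has_field_derivative
      eval_fps (fps_deriv f) (nome \<tau>) * (2 * of_real pi * \<i> * nome \<tau>)) (at \<tau>)"
    by (rule DERIV_chain2[OF has_field_derivative_eval_fps n]) (intro nome_in_disc assms)
  moreover have "open {\<tau>. Im \<tau> > 0}" by (rule open_halfspace_Im_gt)
  ultimately show ?thesis
    unfolding e
    by (rule_tac has_field_derivative_transform_within_open[where S = "{\<tau>. Im \<tau> > 0}"])
       (use assms in \<open>auto simp: mult_ac\<close>)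
qed

lemma Eisenstein_differentiable:
  assumes "Im \<tau> > 0"
  shows "(E2_fun has_field_derivative deriv E2_fun \<tau>) (at \<tau>)"
    and "(E4_fun has_field_derivative deriv E4_fun \<tau>) (at \<tau>)"
    and "(E6_fun has_field_derivative deriv E6_fun \<tau>) (at \<tau>)"
  using has_field_derivative_eval_nome[OF assms conv_radius_Eisenstein_fps(3) E2_fun_eq]
    has_field_derivative_eval_nome[OF assms conv_radius_Eisenstein_fps(1) E4_fun_eq]
    has_field_derivative_eval_nome[OF assms conv_radius_Eisenstein_fps(2) E6_fun_eq]
  by (simp_all add: DERIV_imp_deriv)

lemma RC1_E4_E6:
  assumes "Im \<tau> > 0"
  shows "4 * E4_fun \<tau> * D E6_fun \<tau> - 6 * E6_fun \<tau> * D E4_fun \<tau> = - 2 * (E4_fun \<tau> ^ 3 - E6_fun \<tau> ^ 2)"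
proof -
  have d: "D E4_fun \<tau> = eval_fps (q_deriv E4_fps) (nome \<tau>)" "D E6_fun \<tau> = eval_fps (q_deriv E6_fps) (nome \<tau>)"
    using has_field_derivative_eval_nome[OF assms conv_radius_Eisenstein_fps(1) E4_fun_eq]
      has_field_derivative_eval_nome[OF assms conv_radius_Eisenstein_fps(2) E6_fun_eq]
    by (simp_all add: D_def DERIV_imp_deriv)
  note r = nome_in_disc[OF assms] conv_radius_ge_1_intros conv_radius_Eisenstein_fps
  have "eval_fps (4 * E4_fps * q_deriv E6_fps - 6 * E6_fps * q_deriv E4_fps) (nome \<tau>) =
      4 * E4_fun \<tau> * D E6_fun \<tau> - 6 * E6_fun \<tau> * D E4_fun \<tau>"
    unfolding d E4_fun_eq[OF assms] E6_fun_eq[OF assms]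
    by (subst eval_fps_diff eval_fps_mult, (intro r; simp)+)+ simp
  moreover have "eval_fps (- 2 * (E4_fps ^ 3 - E6_fps ^ 2)) (nome \<tau>) =
      - 2 * (E4_fun \<tau> ^ 3 - E6_fun \<tau> ^ 2)"
    unfolding E4_fun_eq[OF assms] E6_fun_eq[OF assms] neg_numeral_fps_const
    by (subst eval_fps_diff eval_fps_mult eval_fps_power, (intro r; simp)+)+ simp
  ultimately show ?thesis
    by (simp add: E4_E6_Wronskian)
qed

section \<open>Brackets on the polynomial algebra\<close>

lemma const_0 [simp]: "const 0 = 0" and const_1 [simp]: "const 1 = 1"
  and const_minus: "const (- a) = - const a"
  and const_mult: "const (a * b) = const a * const b"
  by (simp_all add: const_def one_pCons)

lemma numeral_eq_const: "numeral n = const (numeral n)"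
  by (simp add: const_def numeral_poly)

text \<open>Polynomial induction from the innermost variable outwards: \<open>pCons a h\<close> is
  the constant \<open>a\<close> plus the variable times \<open>h\<close>. It reduces claims about
  derivations and algebra maps to the generators.\<close>

lemma qmod_induct [case_names const E2 E4 E6 add mult]:
  assumes const: "\<And>c. P (const c)" and gens: "P E2" "P E4" "P E6"
    and add: "\<And>f g. P f \<Longrightarrow> P g \<Longrightarrow> P (f + g)"
    and mult: "\<And>f g. P f \<Longrightarrow> P g \<Longrightarrow> P (f * g)"
  shows "P (f :: qmod)"
proof -
  have z: "P 0" using const[of 0] by simp
  have 1: "P [:[:h:]:]" for h :: "complex poly"
  proof (induction h)
    case (pCons a h)
    have "[:[:pCons a h:]:] = const a + E6 * [:[:h:]:]" by (simp add: const_def E6_def)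
    then show ?case using pCons gens const add mult by metis
  qed (use z in simp)
  have 2: "P [:h:]" for h :: "complex poly poly"
  proof (induction h)
    case (pCons a h)
    have "[:pCons a h:] = [:[:a:]:] + E4 * [:h:]" by (simp add: E4_def)
    then show ?case using pCons gens 1 add mult by metis
  qed (use z in simp)
  show ?thesis
  proof (induction f)
    case (pCons a f)
    have "pCons a f = [:a:] + E2 * f" by (simp add: E2_def)
    then show ?case using pCons gens 2 add mult by metis
  qed (use z in simp)
qed

text \<open>Applying a derivation to all coefficients is again a derivation; used once for
  \<open>dy\<close> and twice, nested, for \<open>dz\<close>.\<close>

lemma map_poly_derivation:
  fixes \<delta> :: "'a::comm_ring_1 \<Rightarrow> 'a"
  assumes add: "\<And>a b. \<delta> (a + b) = \<delta> a + \<delta> b"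
    and mult: "\<And>a b. \<delta> (a * b) = a * \<delta> b + \<delta> a * b"
  shows "map_poly \<delta> (p + q) = map_poly \<delta> p + map_poly \<delta> q"
    and "map_poly \<delta> (p * q) = p * map_poly \<delta> q + map_poly \<delta> p * q"
proof -
  have 0: "\<delta> 0 = 0" using add[of 0 0] by simp
  have sum: "\<delta> (sum f A) = (\<Sum>i\<in>A. \<delta> (f i))" for f :: "nat \<Rightarrow> 'a" and A
    by (induction A rule: infinite_finite_induct) (simp_all add: 0 add)
  show "map_poly \<delta> (p + q) = map_poly \<delta> p + map_poly \<delta> q"
    by (rule poly_eqI) (simp add: coeff_map_poly 0 add)
  show "map_poly \<delta> (p * q) = p * map_poly \<delta> q + map_poly \<delta> p * q"
    by (rule poly_eqI) (simp add: coeff_map_poly 0 coeff_mult sum mult sum.distrib)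
qed

lemma dx_add: "dx (f + g) = dx f + dx g" and dx_mult: "dx (f * g) = f * dx g + dx f * g"
  and dx_gens: "dx (const c) = 0" "dx E2 = 1" "dx E4 = 0" "dx E6 = 0"
  by (simp_all add: dx_def pderiv_add pderiv_mult const_def E2_def E4_def E6_def pderiv_pCons)

lemma dy_add: "dy (f + g) = dy f + dy g" and dy_mult: "dy (f * g) = f * dy g + dy f * g"
  and dy_gens: "dy (const c) = 0" "dy E2 = 0" "dy E4 = 1" "dy E6 = 0"
  unfolding dy_def
  by (rule map_poly_derivation; simp add: pderiv_add pderiv_mult)+
     (simp_all add: const_def E2_def E4_def E6_def pderiv_pCons map_poly_pCons map_poly_1 pCons_one)

lemma dz_add: "dz (f + g) = dz f + dz g" and dz_mult: "dz (f * g) = f * dz g + dz f * g"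
  and dz_gens: "dz (const c) = 0" "dz E2 = 0" "dz E4 = 0" "dz E6 = 1"
  unfolding dz_def
  by ((rule map_poly_derivation; rule map_poly_derivation; simp add: pderiv_add pderiv_mult)+)
     (simp_all add: const_def E2_def E4_def E6_def pderiv_pCons map_poly_pCons map_poly_1 pCons_one)

lemma derivation_minus:
  fixes \<delta> :: "'a::ab_group_add \<Rightarrow> 'a"
  assumes "\<And>f g. \<delta> (f + g) = \<delta> f + \<delta> g"
  shows "\<delta> (- f) = - \<delta> f" "\<delta> (f - g) = \<delta> f - \<delta> g" "\<delta> 0 = 0"
proof -
  show 0: "\<delta> 0 = 0" using assms[of 0 0] by simp
  show m: "\<delta> (- f) = - \<delta> f" for f using assms[of f "- f"] by (simp add: 0 eq_neg_iff_add_eq_0 add.commute)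
  show "\<delta> (f - g) = \<delta> f - \<delta> g" using assms[of f "- g"] by (simp add: m)
qed

lemmas d_add = dx_add dy_add dz_add
  derivation_minus[of dx, OF dx_add] derivation_minus[of dy, OF dy_add] derivation_minus[of dz, OF dz_add]
lemmas d_mult = dx_mult dy_mult dz_mult
lemmas d_gens = dx_gens dy_gens dz_gens dx_gens(1)[of 1, simplified] dy_gens(1)[of 1, simplified]
  dz_gens(1)[of 1, simplified]

lemma d_numeral: "dx (numeral n) = 0" "dy (numeral n) = 0" "dz (numeral n) = 0"
  by (simp_all add: numeral_eq_const d_gens)

text \<open>Oriented as rewrite rules towards the order \<open>dx\<close>, \<open>dy\<close>,
  \<open>dz\<close> from outside to inside.\<close>

lemma d_commute: "dy (dx f) = dx (dy f)" "dz (dx f) = dx (dz f)" "dz (dy f) = dy (dz f)"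
  by (induction f rule: qmod_induct) (simp_all add: d_gens d_add d_mult algebra_simps)

text \<open>The determinant with rows (p, q, r), grad f and grad g.\<close>

definition jacobian_bracket :: "qmod \<Rightarrow> qmod \<Rightarrow> qmod \<Rightarrow> qmod \<Rightarrow> qmod \<Rightarrow> qmod" where
  "jacobian_bracket p q r f g =
    p * (dy f * dz g - dz f * dy g) + q * (dz f * dx g - dx f * dz g) + r * (dx f * dy g - dy f * dx g)"

lemma jacobian_bracket_gens:
  "jacobian_bracket p q r E4 E6 = p" "jacobian_bracket p q r E6 E2 = q" "jacobian_bracket p q r E2 E4 = r"
  "jacobian_bracket p q r E2 E6 = - q"
  by (simp_all add: jacobian_bracket_def d_gens)

text \<open>All second derivatives cancel in the cyclic sum; what is left is, up to sign, the
  product of (p, q, r) . curl (p, q, r) with the Jacobian determinant of f, g, h.\<close>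

lemma jacobian_bracket_Jacobi:
  assumes "p * (dy r - dz q) + q * (dz p - dx r) + r * (dx q - dy p) = 0"
  defines "b \<equiv> jacobian_bracket p q r"
  shows "b f (b g h) + b g (b h f) + b h (b f g) = 0"
proof -
  have "b f (b g h) + b g (b h f) + b h (b f g) =
    - (p * (dy r - dz q) + q * (dz p - dx r) + r * (dx q - dy p)) *
    (dx f * (dy g * dz h - dz g * dy h) + dy f * (dz g * dx h - dx g * dz h) + dz f * (dx g * dy h - dy g * dx h))"
    unfolding b_def jacobian_bracket_def d_mult d_add d_commute
    by algebra
  then show ?thesis using assms by simp
qed

lemma poisson_bracket_jacobian:
  assumes "p * (dy r - dz q) + q * (dz p - dx r) + r * (dx q - dy p) = 0"
  shows "poisson_bracket (jacobian_bracket p q r)"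
  unfolding poisson_bracket_def
proof (intro conjI allI)
  show "jacobian_bracket p q r f (jacobian_bracket p q r g h) +
      jacobian_bracket p q r g (jacobian_bracket p q r h f) +
      jacobian_bracket p q r h (jacobian_bracket p q r f g) = 0" for f g h
    by (rule jacobian_bracket_Jacobi[OF assms])
qed (simp_all add: jacobian_bracket_def d_mult d_add d_gens algebra_simps)

lemma derivation_eq:
  assumes add: "\<And>f g. \<delta> (f + g) = \<delta> f + \<delta> g"
    and mult: "\<And>f g. \<delta> (f * g) = f * \<delta> g + g * \<delta> f"
    and const: "\<And>c. \<delta> (const c) = 0"
  shows "\<delta> f = dx f * \<delta> E2 + dy f * \<delta> E4 + dz f * \<delta> E6"
  by (induction f rule: qmod_induct) (simp_all add: add mult const d_gens d_mult d_add algebra_simps)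

text \<open>A derivation is determined by its values on the generators; this is applied to the first
  argument and, after exchanging the arguments by skew symmetry, to the second.\<close>

lemma poisson_bracket_eq_jacobian:
  assumes "poisson_bracket b"
  shows "b = jacobian_bracket (b E4 E6) (b E6 E2) (b E2 E4)"
proof (intro ext)
  fix f g
  note b = assms[unfolded poisson_bracket_def]
  note add = b[THEN conjunct1, rule_format]
    and scale = b[THEN conjunct2, THEN conjunct2, THEN conjunct1, rule_format]
    and skew = b[THEN conjunct2, THEN conjunct2, THEN conjunct2, THEN conjunct2, THEN conjunct1, rule_format]
    and mult = b[THEN conjunct2, THEN conjunct2, THEN conjunct2,
      THEN conjunct2, THEN conjunct2, THEN conjunct1, rule_format]
  have "b 1 h = 0" for h using mult[of 1 1 h] by simp
  then have const: "b (const c) h = 0" for c h using scale[of c 1 h] by simp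
  have e: "b f h = dx f * b E2 h + dy f * b E4 h + dz f * b E6 h" for f h
    by (rule derivation_eq[of "\<lambda>f. b f h"]) (auto simp: add mult const)
  have self: "b h h = 0" for h
  proof -
    have "b h h + b h h = 0" using skew[of h h] by (simp add: eq_neg_iff_add_eq_0)
    then have "2 * b h h = 0" by simp
    then show ?thesis by simp
  qed
  show "b f g = jacobian_bracket (b E4 E6) (b E6 E2) (b E2 E4) f g"
    unfolding e[of f g] skew[of E2 g] skew[of E4 g] skew[of E6 g]
    unfolding e[of g E2] e[of g E4] e[of g E6] self jacobian_bracket_def
    unfolding skew[of E4 E2] skew[of E6 E4] skew[of E2 E6]
    by (simp add: algebra_simps)
qed

section \<open>Weight and depth read off from coefficients\<close>

definition quasi_weight :: "int \<Rightarrow> int \<Rightarrow> qmod \<Rightarrow> bool" where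
  "quasi_weight k s f \<longleftrightarrow> (\<forall>j a b. coeff (coeff (coeff f j) a) b \<noteq> 0 \<longrightarrow>
     2 * int j + 4 * int a + 6 * int b = k \<and> int j \<le> s)"

lemma quasi_weightD:
  "quasi_weight k s f \<Longrightarrow> 2 * int j + 4 * int a + 6 * int b \<noteq> k \<or> int j > s \<Longrightarrow>
    coeff (coeff (coeff f j) a) b = 0"
  unfolding quasi_weight_def by fastforce

lemma quasi_weight_add: "quasi_weight k s f \<Longrightarrow> quasi_weight k s g \<Longrightarrow> quasi_weight k s (f + g)"
  unfolding quasi_weight_def by (metis add.right_neutral coeff_add)

lemma quasi_weight_minus: "quasi_weight k s f \<Longrightarrow> quasi_weight k s (- f)"
  unfolding quasi_weight_def by simp

lemma quasi_weight_diff: "quasi_weight k s f \<Longrightarrow> quasi_weight k s g \<Longrightarrow> quasi_weight k s (f - g)"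
  using quasi_weight_add[of k s f "- g"] quasi_weight_minus[of k s g] by simp

lemma quasi_weight_sum: "(\<And>i. i \<in> A \<Longrightarrow> quasi_weight k s (f i)) \<Longrightarrow> quasi_weight k s (sum f A)"
  by (induction A rule: infinite_finite_induct) (auto intro: quasi_weight_add simp: quasi_weight_def[of _ _ 0])

lemma quasi_weight_mono: "quasi_weight k s f \<Longrightarrow> s \<le> t \<Longrightarrow> quasi_weight k t f"
  unfolding quasi_weight_def by fastforce

lemma quasi_weight_const: "quasi_weight 0 0 (const c)"
  unfolding quasi_weight_def const_def by (auto simp: coeff_pCons split: nat.splits)

lemma quasi_weight_gens: "quasi_weight 2 1 E2" "quasi_weight 4 0 E4" "quasi_weight 6 0 E6"
  unfolding quasi_weight_def E2_def E4_def E6_def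
  by (auto simp: coeff_pCons coeff_1 split: nat.splits if_splits)

lemma quasi_weight_mult:
  assumes f: "quasi_weight k s f" and g: "quasi_weight l t g"
  shows "quasi_weight (k + l) (s + t) (f * g)"
proof -
  have "coeff (coeff (coeff (f * g) j) a) b = 0"
    if "2 * int j + 4 * int a + 6 * int b \<noteq> k + l \<or> int j > s + t" for j a b
  proof -
    have "coeff (coeff (coeff f j') a') b' * coeff (coeff (coeff g (j - j')) (a - a')) (b - b') = 0"
      if "j' \<le> j" "a' \<le> a" "b' \<le> b" for j' a' b'
    proof (rule ccontr)
      assume "\<not> ?thesis"
      then have "coeff (coeff (coeff f j') a') b' \<noteq> 0"
        "coeff (coeff (coeff g (j - j')) (a - a')) (b - b') \<noteq> 0" by auto
      then show False
        using f g that \<open>2 * int j + 4 * int a + 6 * int b \<noteq> k + l \<or> int j > s + t\<close>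
        unfolding quasi_weight_def by (fastforce simp: of_nat_diff)
    qed
    then show ?thesis
      by (auto simp: coeff_mult coeff_sum intro!: sum.neutral)
  qed
  then show ?thesis unfolding quasi_weight_def by (metis linorder_not_less)
qed

lemma quasi_weight_power: "quasi_weight k s f \<Longrightarrow> quasi_weight (int n * k) (int n * s) (f ^ n)"
proof (induction n)
  case 0
  then show ?case using quasi_weight_const[of 1] by simp
next
  case (Suc n)
  then show ?case using quasi_weight_mult[of k s f "int n * k" "int n * s" "f ^ n"]
    by (simp add: algebra_simps)
qed

lemma coeff_dx: "coeff (coeff (coeff (dx f) j) a) b = of_nat (Suc j) * coeff (coeff (coeff f (Suc j)) a) b"
  by (simp add: dx_def coeff_pderiv of_nat_poly)

lemma coeff_dy: "coeff (coeff (coeff (dy f) j) a) b = of_nat (Suc a) * coeff (coeff (coeff f j) (Suc a)) b"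
  by (simp add: dy_def coeff_map_poly coeff_pderiv of_nat_poly)

lemma coeff_dz: "coeff (coeff (coeff (dz f) j) a) b = of_nat (Suc b) * coeff (coeff (coeff f j) a) (Suc b)"
  by (simp add: dz_def coeff_map_poly coeff_pderiv)

text \<open>Weight and depth are integers because \<open>k - 2\<close> and \<open>s - 1\<close> may
  become negative; the condition then forces the derivative to be 0.\<close>

lemma quasi_weight_dx: "quasi_weight k s f \<Longrightarrow> quasi_weight (k - 2) (s - 1) (dx f)"
  unfolding quasi_weight_def coeff_dx by (force)

lemma quasi_weight_dy: "quasi_weight k s f \<Longrightarrow> quasi_weight (k - 4) s (dy f)"
  unfolding quasi_weight_def coeff_dy by (force)

lemma quasi_weight_dz: "quasi_weight k s f \<Longrightarrow> quasi_weight (k - 6) s (dz f)"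
  unfolding quasi_weight_def coeff_dz by (force)

text \<open>Multiplication by the variable undoes the index shift of the derivative, so monomials
  are eigenvectors.\<close>

lemma coeff_E_mult:
  "coeff (coeff (coeff (E2 * dx f) j) a) b = of_nat j * coeff (coeff (coeff f j) a) b"
  "coeff (coeff (coeff (E4 * dy f) j) a) b = of_nat a * coeff (coeff (coeff f j) a) b"
  "coeff (coeff (coeff (E6 * dz f) j) a) b = of_nat b * coeff (coeff (coeff f j) a) b"
proof -
  have "E2 * dx f = pCons 0 (dx f)" by (simp add: E2_def)
  then show "coeff (coeff (coeff (E2 * dx f) j) a) b = of_nat j * coeff (coeff (coeff f j) a) b"
    by (cases j) (simp_all add: coeff_dx)
  have "coeff (coeff (E4 * dy f) j) a = coeff (pCons 0 (coeff (dy f) j)) a" by (simp add: E4_def)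
  then show "coeff (coeff (coeff (E4 * dy f) j) a) b = of_nat a * coeff (coeff (coeff f j) a) b"
    by (cases a) (simp_all add: coeff_dy)
  have "coeff (coeff (coeff (E6 * dz f) j) a) b = coeff (pCons 0 (coeff (coeff (dz f) j) a)) b"
    by (simp add: E6_def)
  then show "coeff (coeff (coeff (E6 * dz f) j) a) b = of_nat b * coeff (coeff (coeff f j) a) b"
    by (cases b) (simp_all add: coeff_dz)
qed

text \<open>The Euler vector field of the grading: it multiplies an element of weight k by
  k.\<close>

definition weight_field :: "qmod \<Rightarrow> qmod" where
  "weight_field f = 2 * (E2 * dx f) + 4 * (E4 * dy f) + 6 * (E6 * dz f)"

lemma coeff_const_mult: "coeff (coeff (coeff (const c * f) j) a) b = c * coeff (coeff (coeff f j) a) b"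
  by (simp add: const_def)

lemma coeff_weight_field:
  "coeff (coeff (coeff (weight_field f) j) a) b =
    of_nat (2 * j + 4 * a + 6 * b) * coeff (coeff (coeff f j) a) b"
  unfolding weight_field_def numeral_eq_const coeff_add coeff_const_mult coeff_E_mult
  by (simp add: algebra_simps)

lemma qmod_eqI:
  "(\<And>j a b. coeff (coeff (coeff f j) a) b = coeff (coeff (coeff g j) a) b) \<Longrightarrow> (f :: qmod) = g"
  by (intro poly_eqI)

lemma weight_field_quasi_weight:
  assumes "quasi_weight k s f"
  shows "weight_field f = const (of_int k) * f"
proof (rule qmod_eqI)
  fix j a b
  show "coeff (coeff (coeff (weight_field f) j) a) b = coeff (coeff (coeff (const (of_int k) * f) j) a) b"
  proof (cases "coeff (coeff (coeff f j) a) b = 0")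
    case False
    then have "k = int (2 * j + 4 * a + 6 * b)" using assms by (auto simp: quasi_weight_def)
    then show ?thesis unfolding coeff_weight_field coeff_const_mult by simp
  qed (simp add: coeff_weight_field coeff_const_mult)
qed

text \<open>The eigenvalue 2 j + 4 a + 6 b of a monomial vanishes only for the constant
  monomial.\<close>

lemma weight_field_eq_0:
  assumes "weight_field f = 0"
  shows "f \<in> range const"
proof -
  have "f = const (coeff (coeff (coeff f 0) 0) 0)"
  proof (rule qmod_eqI)
    fix j a b
    have "of_nat (2 * j + 4 * a + 6 * b) * coeff (coeff (coeff f j) a) b = 0"
      unfolding coeff_weight_field[symmetric] assms by simp
    then have "2 * j + 4 * a + 6 * b = 0 \<or> coeff (coeff (coeff f j) a) b = 0"
      by (simp only: mult_eq_0_iff of_nat_eq_0_iff)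
    then show "coeff (coeff (coeff f j) a) b = coeff (coeff (coeff (const (coeff (coeff (coeff f 0) 0) 0)) j) a) b"
      by (auto simp: const_def coeff_pCons split: nat.splits)
  qed
  then show ?thesis by blast
qed

lemma finite_weight_indices: "finite {(a, b). 4 * int a + 6 * int b = k}"
  by (rule finite_subset[of _ "{..nat k} \<times> {..nat k}"]) auto

lemma E4_E6_monomial: "const c * E4 ^ a * E6 ^ b = [:monom (monom c b) a:]"
proof -
  have "E4 ^ a = [:monom 1 a:]"
    by (induction a) (simp_all add: E4_def monom_Suc monom_0 pCons_one)
  moreover have "E6 ^ b = [:[:monom 1 b:]:]"
    by (induction b) (simp_all add: E6_def monom_Suc monom_0 pCons_one)
  ultimately show ?thesis by (simp add: const_def smult_monom mult_monom)
qed

lemma quasi_weight_expansion: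
  assumes "quasi_weight k 0 [:g:]"
  shows "[:g:] = (\<Sum>(a, b) \<in> {(a, b). 4 * int a + 6 * int b = k}. const (coeff (coeff g a) b) * E4 ^ a * E6 ^ b)"
proof (rule qmod_eqI)
  fix j a b
  let ?I = "{(a, b). 4 * int a + 6 * int b = k}"
  \<comment> \<open>Only the summand with index (a, b) contributes to this coefficient. If (a, b)
    lies outside \<open>?I\<close>, the weight hypothesis makes the coefficient of \<open>g\<close>
    vanish as well.\<close>
  have "coeff (coeff (coeff (\<Sum>(a, b) \<in> ?I. const (coeff (coeff g a) b) * E4 ^ a * E6 ^ b) j) a) b =
      (\<Sum>i \<in> ?I. if i = (a, b) then if j = 0 then coeff (coeff g a) b else 0 else 0)"
    unfolding E4_E6_monomial coeff_sum
    by (rule sum.cong) (auto simp: coeff_pCons split: nat.splits if_splits)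
  also have "\<dots> = coeff (coeff (coeff [:g:] j) a) b"
    using quasi_weightD[OF assms, of 0 a b] finite_weight_indices[of k]
    by (auto simp: coeff_pCons split: nat.splits)
  finally show "coeff (coeff (coeff [:g:] j) a) b =
    coeff (coeff (coeff (\<Sum>(a, b) \<in> ?I. const (coeff (coeff g a) b) * E4 ^ a * E6 ^ b) j) a) b" ..
qed

lemma modular_forms_quasi_weight: "f \<in> modular_forms k \<Longrightarrow> quasi_weight k 0 f"
proof -
  assume "f \<in> modular_forms k"
  then obtain c where f: "f = (\<Sum>(a, b) \<in> {(a, b). 4 * int a + 6 * int b = k}. const (c a b) * E4 ^ a * E6 ^ b)"
    by (auto simp: modular_forms_def)
  have "quasi_weight (0 + int a * 4 + int b * 6) (0 + int a * 0 + int b * 0) (const (c a b) * E4 ^ a * E6 ^ b)" for a b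
    by (intro quasi_weight_mult quasi_weight_power quasi_weight_const quasi_weight_gens)
  then show ?thesis
    unfolding f by (intro quasi_weight_sum) (auto simp: algebra_simps)
qed

text \<open>Replaces the existential decomposition along powers of E2 by a condition on
  coefficients, which behaves well under products and derivatives. The coefficient of
  \<open>E2 ^ j\<close> serves as the modular form in that decomposition.\<close>

lemma quasimodular_forms_eq: "quasimodular_forms k s = {f. quasi_weight k (int s) f}"
proof (intro equalityI subsetI; clarify)
  fix f assume "f \<in> quasimodular_forms k s"
  then obtain m where m: "\<And>j. j \<le> s \<Longrightarrow> m j \<in> modular_forms (k - 2 * int j)"
    and f: "f = (\<Sum>j\<le>s. m j * E2 ^ j)"
    by (auto simp: quasimodular_forms_def)
  show "quasi_weight k (int s) f"
    unfolding f
  proof (rule quasi_weight_sum)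
    fix j assume "j \<in> {..s}"
    then have "quasi_weight ((k - 2 * int j) + int j * 2) (0 + int j * 1) (m j * E2 ^ j)"
      by (intro quasi_weight_mult quasi_weight_power quasi_weight_gens modular_forms_quasi_weight m) simp
    then show "quasi_weight k (int s) (m j * E2 ^ j)"
      using \<open>j \<in> {..s}\<close> by (simp add: quasi_weight_mono[of k "int j"])
  qed
next
  fix f assume f: "quasi_weight k (int s) f"
  have E2_power: "E2 ^ j = monom 1 j" for j
    by (induction j) (simp_all add: E2_def monom_Suc monom_0 pCons_one)
  have "quasi_weight (k - 2 * int j) 0 [:coeff f j:]" for j
    using f by (fastforce simp: quasi_weight_def coeff_pCons split: nat.splits)
  then have m: "[:coeff f j:] \<in> modular_forms (k - 2 * int j)" for j
    unfolding modular_forms_def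
    by (intro CollectI exI[of _ "\<lambda>a. coeff (coeff (coeff f j) a)"]) (rule quasi_weight_expansion)
  have "f = (\<Sum>j\<le>s. [:coeff f j:] * E2 ^ j)"
  proof (rule poly_eqI)
    fix i
    have "coeff f i = 0" if "i > s"
      using that f by (intro poly_eqI) (auto intro: quasi_weightD)
    then show "coeff f i = coeff (\<Sum>j\<le>s. [:coeff f j:] * E2 ^ j) i"
      by (auto simp: coeff_sum E2_power if_distrib cong: if_cong)
  qed
  with m show "f \<in> quasimodular_forms k s"
    unfolding quasimodular_forms_def by (intro CollectI exI[of _ "\<lambda>j. [:coeff f j:]"]) blast
qed

text \<open>The derivative pairs lower the weight by 10, 8 and 6 against weights 12, 10 and 8 of
  \<open>p\<close>, \<open>q\<close>, \<open>r\<close>, a net gain of 2. The depth 1 of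
  \<open>q\<close> and \<open>r\<close> offsets the depth lost under \<open>dx\<close>.\<close>

lemma quasi_weight_jacobian_bracket:
  assumes p: "quasi_weight 12 0 p" and q: "quasi_weight 10 1 q" and r: "quasi_weight 8 1 r"
    and f: "quasi_weight k s f" and g: "quasi_weight l t g"
  shows "quasi_weight (k + l + 2) (s + t) (jacobian_bracket p q r f g)"
proof -
  note d = quasi_weight_dx[OF f] quasi_weight_dy[OF f] quasi_weight_dz[OF f]
    quasi_weight_dx[OF g] quasi_weight_dy[OF g] quasi_weight_dz[OF g]
  have "quasi_weight (12 + ((k - 4) + (l - 6))) (0 + (s + t)) (p * (dy f * dz g - dz f * dy g))"
    using quasi_weight_mult[OF d(2) d(6)] quasi_weight_mult[OF d(3) d(5)]
    by (intro quasi_weight_mult[OF p] quasi_weight_diff) (simp_all add: algebra_simps)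
  moreover have "quasi_weight (10 + ((k - 6) + (l - 2))) (1 + (s + t - 1)) (q * (dz f * dx g - dx f * dz g))"
    using quasi_weight_mult[OF d(3) d(4)] quasi_weight_mult[OF d(1) d(6)]
    by (intro quasi_weight_mult[OF q] quasi_weight_diff) (simp_all add: algebra_simps)
  moreover have "quasi_weight (8 + ((k - 2) + (l - 4))) (1 + (s + t - 1)) (r * (dx f * dy g - dy f * dx g))"
    using quasi_weight_mult[OF d(1) d(5)] quasi_weight_mult[OF d(2) d(4)]
    by (intro quasi_weight_mult[OF r] quasi_weight_diff) (simp_all add: algebra_simps)
  ultimately show ?thesis
    unfolding jacobian_bracket_def by (intro quasi_weight_add) (simp_all add: algebra_simps)
qed

section \<open>Polynomials as functions on the upper half-plane\<close>

context
  fixes \<tau> :: complex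
begin

lemma qm_fun_hom:
  "qm_fun (f + g) \<tau> = qm_fun f \<tau> + qm_fun g \<tau>" "qm_fun (f - g) \<tau> = qm_fun f \<tau> - qm_fun g \<tau>"
  "qm_fun (- f) \<tau> = - qm_fun f \<tau>" "qm_fun (f * g) \<tau> = qm_fun f \<tau> * qm_fun g \<tau>"
  "qm_fun (f ^ n) \<tau> = qm_fun f \<tau> ^ n"
  "qm_fun 0 \<tau> = 0" "qm_fun 1 \<tau> = 1" "qm_fun (const c) \<tau> = c" "qm_fun (numeral m) \<tau> = numeral m"
  "qm_fun E2 \<tau> = E2_fun \<tau>" "qm_fun E4 \<tau> = E4_fun \<tau>" "qm_fun E6 \<tau> = E6_fun \<tau>"
  by (simp_all add: qm_fun_def const_def E2_def E4_def E6_def numeral_poly)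

end

lemma qm_fun_has_derivative:
  assumes "(E2_fun has_field_derivative e2) (at \<tau>)" "(E4_fun has_field_derivative e4) (at \<tau>)"
    "(E6_fun has_field_derivative e6) (at \<tau>)"
  shows "(qm_fun f has_field_derivative
    qm_fun (dx f) \<tau> * e2 + qm_fun (dy f) \<tau> * e4 + qm_fun (dz f) \<tau> * e6) (at \<tau>)"
proof (induction f rule: qmod_induct)
  case (const c)
  then show ?case by (simp add: qm_fun_hom[abs_def] d_gens)
next
  case E2
  then show ?case using assms(1) by (simp add: qm_fun_hom d_gens)
next
  case E4
  then show ?case using assms(2) by (simp add: qm_fun_hom d_gens)
next
  case E6
  then show ?case using assms(3) by (simp add: qm_fun_hom d_gens)
next
  case (add f g)
  then show ?case using DERIV_add[OF add] by (simp add: qm_fun_hom[abs_def] d_add algebra_simps)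
next
  case (mult f g)
  then show ?case using DERIV_mult[OF mult] by (simp add: qm_fun_hom[abs_def] d_mult algebra_simps)
qed

section \<open>The family of brackets\<close>

text \<open>The second component is the bracket of E6 with E2, hence the sign opposite to that of
  the bracket of E2 with E6.\<close>

definition eisenstein_bracket :: "complex \<Rightarrow> qmod \<Rightarrow> qmod \<Rightarrow> qmod" where
  "eisenstein_bracket lam = jacobian_bracket (- 2 * Delta)
     (const (1 / 2) * (2 * E4 ^ 2 * E2 - const lam * E4 * E6))
     (- const (1 / 3) * (2 * E6 * E2 - const lam * E4 ^ 2))"

text \<open>All coefficients are expressed through \<open>1/6\<close>, so that the Groebner basis method needs only the
  relation \<open>6 u = 1\<close>.\<close>

lemma const_fractions: "const (1 / 2) = 3 * const (1 / 6)" "const (1 / 3) = 2 * const (1 / 6)"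
  "6 * const (1 / 6) = 1"
  unfolding numeral_eq_const const_mult[symmetric] by simp_all

lemmas eval_d = d_add d_mult d_gens d_numeral

text \<open>The curl is 7/6 (lam y, 4 z, 6 y^2). It enters both the Jacobi identity and the failure
  of unimodularity.\<close>

lemma eisenstein_curl:
  fixes lam :: complex
  defines "p \<equiv> - 2 * Delta" and "q \<equiv> const (1 / 2) * (2 * E4 ^ 2 * E2 - const lam * E4 * E6)"
    and "r \<equiv> - const (1 / 3) * (2 * E6 * E2 - const lam * E4 ^ 2)"
  shows "dy r - dz q = 7 * const (1 / 6) * const lam * E4"
    and "dz p - dx r = 28 * const (1 / 6) * E6"
    and "dx q - dy p = 42 * const (1 / 6) * E4 ^ 2"
proof -
  note u = const_fractions(3)
  show "dy r - dz q = 7 * const (1 / 6) * const lam * E4"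
    unfolding q_def r_def const_fractions(1,2) by (simp add: eval_d power2_eq_square algebra_simps)
  have "dz p - dx r = 4 * E6 + 4 * const (1 / 6) * E6"
    unfolding p_def r_def const_fractions(1,2) Delta_def
    by (simp add: eval_d power2_eq_square power3_eq_cube algebra_simps)
  then show "dz p - dx r = 28 * const (1 / 6) * E6"
    using u by algebra
  have "dx q - dy p = 6 * const (1 / 6) * E4 ^ 2 + 6 * E4 ^ 2"
    unfolding p_def q_def const_fractions(1,2) Delta_def
    by (simp add: eval_d power2_eq_square power3_eq_cube algebra_simps)
  then show "dx q - dy p = 42 * const (1 / 6) * E4 ^ 2"
    using u by algebra
qed

text \<open>In (p, q, r) . (lam y, 4 z, 6 y^2) the terms with x and the terms with lam cancel
  separately.\<close>

lemma poisson_bracket_eisenstein: "poisson_bracket (eisenstein_bracket lam)"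
  unfolding eisenstein_bracket_def
proof (rule poisson_bracket_jacobian)
  show "- 2 * Delta * (dy (- const (1 / 3) * (2 * E6 * E2 - const lam * E4 ^ 2)) -
        dz (const (1 / 2) * (2 * E4 ^ 2 * E2 - const lam * E4 * E6))) +
      const (1 / 2) * (2 * E4 ^ 2 * E2 - const lam * E4 * E6) *
        (dz (- 2 * Delta) - dx (- const (1 / 3) * (2 * E6 * E2 - const lam * E4 ^ 2))) +
      - const (1 / 3) * (2 * E6 * E2 - const lam * E4 ^ 2) *
        (dx (const (1 / 2) * (2 * E4 ^ 2 * E2 - const lam * E4 * E6)) - dy (- 2 * Delta)) = 0"
    unfolding eisenstein_curl unfolding const_fractions(1,2) Delta_def
    using const_fractions(3) by algebra
qed

lemma eisenstein_bracket_gens: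
  "eisenstein_bracket lam E4 E6 = - 2 * Delta"
  "eisenstein_bracket lam E2 E4 = - const (1 / 3) * (2 * E6 * E2 - const lam * E4 ^ 2)"
  "eisenstein_bracket lam E2 E6 = - const (1 / 2) * (2 * E4 ^ 2 * E2 - const lam * E4 * E6)"
  "eisenstein_bracket lam E6 E2 = const (1 / 2) * (2 * E4 ^ 2 * E2 - const lam * E4 * E6)"
  by (simp_all add: eisenstein_bracket_def jacobian_bracket_gens)

lemma modular_algebra_D: "f \<in> modular_algebra \<Longrightarrow> dx f = 0 \<and> dy f \<in> modular_algebra \<and> dz f \<in> modular_algebra"
  by (auto simp: modular_algebra_def dx_def dy_def dz_def map_poly_pCons pderiv_pCons)

lemma modular_algebra_ops:
  assumes "f \<in> modular_algebra" "g \<in> modular_algebra"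
  shows "f + g \<in> modular_algebra" "f - g \<in> modular_algebra" "f * g \<in> modular_algebra" "f ^ n \<in> modular_algebra"
proof -
  obtain a b where "f = [:a:]" "g = [:b:]" using assms by (auto simp: modular_algebra_def)
  moreover have "[:a:] ^ n = [:a ^ n:]" for a :: "complex poly poly"
    by (induction n) (simp_all add: pCons_one)
  ultimately show "f + g \<in> modular_algebra" "f - g \<in> modular_algebra" "f * g \<in> modular_algebra"
    "f ^ n \<in> modular_algebra"
    by (auto simp: modular_algebra_def)
qed

lemma Delta_modular: "- 2 * Delta \<in> modular_algebra"
proof -
  have "E4 \<in> modular_algebra" "E6 \<in> modular_algebra" "- 2 \<in> modular_algebra"
    by (auto simp: modular_algebra_def E4_def E6_def numeral_poly)
  then show ?thesis unfolding Delta_def by (intro modular_algebra_ops)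
qed

lemma modular_forms_modular_algebra: "f \<in> modular_forms k \<Longrightarrow> f \<in> modular_algebra"
proof -
  assume "f \<in> modular_forms k"
  then have "coeff (coeff (coeff f j) a) b = 0" if "j > 0" for j a b
    using that by (intro quasi_weightD[OF modular_forms_quasi_weight]) auto
  then have "f = [:coeff f 0:]"
    by (intro qmod_eqI) (auto simp: coeff_pCons split: nat.splits)
  then show ?thesis unfolding modular_algebra_def by blast
qed

text \<open>By the Euler identity for the weight grading, both brackets are the Jacobian of \<open>f, g\<close> with respect
  to \<open>E4, E6\<close> times the bracket of \<open>E4\<close> and \<open>E6\<close>.\<close>

lemma restricts_to_RC1_eisenstein: "restricts_to_RC1 (eisenstein_bracket lam)"
  unfolding restricts_to_RC1_def
proof (intro conjI ballI allI impI)
  fix f g assume fg: "f \<in> modular_algebra" "g \<in> modular_algebra"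
  note d = modular_algebra_D[OF fg(1)] modular_algebra_D[OF fg(2)]
  have "eisenstein_bracket lam f g = - 2 * Delta * (dy f * dz g - dz f * dy g)"
    using d by (simp add: eisenstein_bracket_def jacobian_bracket_def)
  also have "\<dots> \<in> modular_algebra"
    using d by (intro modular_algebra_ops(2,3) Delta_modular) auto
  finally show "eisenstein_bracket lam f g \<in> modular_algebra" .
next
  fix k l f g \<tau>
  assume f: "f \<in> modular_forms k" and g: "g \<in> modular_forms l" and \<tau>: "Im \<tau> > 0"
  let ?q = "\<lambda>h. qm_fun h \<tau>"
  have 0: "dx f = 0" "dx g = 0"
    using f g modular_forms_modular_algebra modular_algebra_D by blast+
  \<comment> \<open>The chain rule; the contribution of the derivative of E2 disappears with
    \<open>dx h\<close>.\<close>
  have D: "D (qm_fun h) \<tau> = ?q (dy h) * D E4_fun \<tau> + ?q (dz h) * D E6_fun \<tau>" if "dx h = 0" for h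
    unfolding D_def DERIV_imp_deriv[OF qm_fun_has_derivative[OF Eisenstein_differentiable[OF \<tau>], of h]] that
    by (simp add: qm_fun_hom add_divide_distrib)
  have euler: "of_int m * ?q h = 4 * (E4_fun \<tau> * ?q (dy h)) + 6 * (E6_fun \<tau> * ?q (dz h))"
    if "h \<in> modular_forms m" "dx h = 0" for m h
  proof -
    have "?q (const (of_int m) * h) = ?q (weight_field h)"
      using weight_field_quasi_weight[OF modular_forms_quasi_weight[OF that(1)]] by simp
    then show ?thesis unfolding weight_field_def that(2) by (simp add: qm_fun_hom)
  qed
  have "RC1 k l (qm_fun f) (qm_fun g) \<tau> =
      (4 * (E4_fun \<tau> * ?q (dy f)) + 6 * (E6_fun \<tau> * ?q (dz f))) * D (qm_fun g) \<tau> -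
      (4 * (E4_fun \<tau> * ?q (dy g)) + 6 * (E6_fun \<tau> * ?q (dz g))) * D (qm_fun f) \<tau>"
    unfolding RC1_def euler[OF f 0(1), symmetric] euler[OF g 0(2), symmetric] ..
  also have "\<dots> = (4 * E4_fun \<tau> * D E6_fun \<tau> - 6 * E6_fun \<tau> * D E4_fun \<tau>) *
      (?q (dy f) * ?q (dz g) - ?q (dz f) * ?q (dy g))"
    unfolding D[OF 0(1)] D[OF 0(2)] by (simp add: algebra_simps)
  also have "\<dots> = ?q (eisenstein_bracket lam f g)"
    unfolding RC1_E4_E6[OF \<tau>] eisenstein_bracket_def jacobian_bracket_def Delta_def 0
    by (simp add: qm_fun_hom)
  finally show "?q (eisenstein_bracket lam f g) = RC1 k l (qm_fun f) (qm_fun g) \<tau>" ..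
qed

lemma quasi_weight_scale: "quasi_weight k s f \<Longrightarrow> quasi_weight k s (const c * f)"
  using quasi_weight_mult[OF quasi_weight_const] by fastforce

lemma admissible_eisenstein: "admissible (eisenstein_bracket lam)"
  unfolding admissible_def
proof (intro conjI allI impI ballI)
  fix k l s t f g
  assume f: "f \<in> quasimodular_forms k s" and g: "g \<in> quasimodular_forms l t"
  note w = quasi_weight_gens
  have E: "quasi_weight 12 0 (E4 ^ 3)" "quasi_weight 12 0 (E6 ^ 2)" "quasi_weight 8 0 (E4 ^ 2)"
    using quasi_weight_power[OF w(2), of 3] quasi_weight_power[OF w(3), of 2]
      quasi_weight_power[OF w(2), of 2] by simp_all
  have "quasi_weight 12 0 (const (- 2) * Delta)"
    unfolding Delta_def by (intro quasi_weight_scale quasi_weight_diff E)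
  then have p: "quasi_weight 12 0 (- 2 * Delta)" by (simp add: const_minus numeral_eq_const)
  \<comment> \<open>The term with \<open>lam\<close> has depth 0 and is regarded as having depth at
    most 1 to match the term with E2.\<close>
  have "quasi_weight 10 1 (const (1 / 2) * (const 2 * (E4 ^ 2 * E2) - const lam * (E4 * E6)))"
    using quasi_weight_mult[OF E(3) w(1)] quasi_weight_mono[OF quasi_weight_mult[OF w(2) w(3)], of 1]
    by (intro quasi_weight_scale quasi_weight_diff) simp_all
  then have q: "quasi_weight 10 1 (const (1 / 2) * (2 * E4 ^ 2 * E2 - const lam * E4 * E6))"
    by (simp add: numeral_eq_const mult.assoc)
  have "quasi_weight 8 1 (const (- 1 / 3) * (const 2 * (E6 * E2) - const lam * E4 ^ 2))"
    using quasi_weight_mult[OF w(3) w(1)] quasi_weight_mono[OF E(3), of 1]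
    by (intro quasi_weight_scale quasi_weight_diff) simp_all
  then have r: "quasi_weight 8 1 (- const (1 / 3) * (2 * E6 * E2 - const lam * E4 ^ 2))"
    by (simp add: numeral_eq_const mult.assoc const_minus[symmetric] del: mult_minus_left)
  show "eisenstein_bracket lam f g \<in> quasimodular_forms (k + l + 2) (s + t)"
    using f g quasi_weight_jacobian_bracket[OF p q r]
    unfolding quasimodular_forms_eq eisenstein_bracket_def by simp
qed (fact poisson_bracket_eisenstein restricts_to_RC1_eisenstein)+

text \<open>The components \<open>p, q, r\<close> have no terms of degree below 2, hence neither does their cross product
  with a gradient, but the curl contains the linear term \<open>7/6 lam y\<close>.\<close>

lemma not_unimodular_eisenstein:
  assumes "lam \<noteq> 0"
  shows "\<not> unimodular (eisenstein_bracket lam)"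
proof
  assume "unimodular (eisenstein_bracket lam)"
  then obtain k where "dy (- const (1 / 3) * (2 * E6 * E2 - const lam * E4 ^ 2)) -
      dz (const (1 / 2) * (2 * E4 ^ 2 * E2 - const lam * E4 * E6)) =
      const (1 / 2) * (2 * E4 ^ 2 * E2 - const lam * E4 * E6) * dz k -
      - const (1 / 3) * (2 * E6 * E2 - const lam * E4 ^ 2) * dy k"
    unfolding unimodular_def Let_def eisenstein_bracket_gens curl.simps grad_def cross.simps by auto
  then have "7 * const (1 / 6) * const lam * E4 =
      const (1 / 2) * (2 * E4 ^ 2 * E2 - const lam * E4 * E6) * dz k -
      - const (1 / 3) * (2 * E6 * E2 - const lam * E4 ^ 2) * dy k"
    unfolding eisenstein_curl .
  \<comment> \<open>Differentiating by y and evaluating at the origin extracts the coefficient of y.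
    On the right every product-rule term keeps a factor that vanishes there, while the left gives
    7/6 \<open>lam\<close>.\<close>
  then have *: "dy (7 * const (1 / 6) * const lam * E4) =
      dy (const (1 / 2) * (2 * E4 ^ 2 * E2 - const lam * E4 * E6) * dz k -
      - const (1 / 3) * (2 * E6 * E2 - const lam * E4 ^ 2) * dy k)"
    by simp
  let ?e = "\<lambda>f :: qmod. coeff (coeff (coeff f 0) 0) 0"
  have e: "?e (f * g) = ?e f * ?e g" "?e (const c) = c" "?e E2 = 0" "?e E4 = 0" "?e E6 = 0"
    "?e (numeral n) = numeral n" for f g c n
    by (simp_all add: coeff_mult_0 const_def E2_def E4_def E6_def numeral_poly)
  from arg_cong[OF *, of ?e] show False
    using assms by (simp add: eval_d power2_eq_square e)
qed

section \<open>Isomorphisms by rescaling E2\<close>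

definition scale_E2 :: "complex \<Rightarrow> qmod \<Rightarrow> qmod" where
  "scale_E2 c f = pcompose f (const c * E2)"

lemma scale_E2_hom:
  "scale_E2 c (f + g) = scale_E2 c f + scale_E2 c g" "scale_E2 c (f - g) = scale_E2 c f - scale_E2 c g"
  "scale_E2 c (- f) = - scale_E2 c f"
  "scale_E2 c (f * g) = scale_E2 c f * scale_E2 c g" "scale_E2 c [:h:] = [:h:]"
  by (simp_all add: scale_E2_def pcompose_add pcompose_diff pcompose_mult pcompose_uminus)

lemma scale_E2_gens: "scale_E2 c (const d) = const d" "scale_E2 c E2 = const c * E2"
  "scale_E2 c E4 = E4" "scale_E2 c E6 = E6" "scale_E2 c (numeral n) = numeral n" "scale_E2 c 1 = 1"
  "scale_E2 c 0 = 0"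
  by (simp_all add: scale_E2_def const_def E2_def E4_def E6_def pcompose_pCons pcompose_1 numeral_poly)

lemma scale_E2_inverse: "c \<noteq> 0 \<Longrightarrow> scale_E2 (1 / c) (scale_E2 c f) = f"
  by (induction f rule: qmod_induct)
     (simp_all add: scale_E2_hom scale_E2_gens mult.assoc[symmetric] const_mult[symmetric])

lemma algebra_iso_scale_E2:
  assumes "c \<noteq> 0"
  shows "algebra_iso (scale_E2 c)"
proof -
  have "bij (scale_E2 c)"
    using scale_E2_inverse[OF assms] scale_E2_inverse[of "1 / c"] assms
    by (intro o_bij[of "scale_E2 (1 / c)"]) (auto simp: fun_eq_iff)
  then show ?thesis
    unfolding algebra_iso_def by (simp add: scale_E2_hom scale_E2_gens)
qed

lemma d_scale_E2:
  "dx (scale_E2 c f) = const c * scale_E2 c (dx f)" "dy (scale_E2 c f) = scale_E2 c (dy f)"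
  "dz (scale_E2 c f) = scale_E2 c (dz f)"
  by (induction f rule: qmod_induct) (simp_all add: scale_E2_hom scale_E2_gens eval_d algebra_simps)

text \<open>Rescaling fixes \<open>p\<close> and sends \<open>q\<close> and \<open>r\<close> for
  \<open>lam\<close> to c times those for \<open>mu\<close>. This c is the factor that
  \<open>dx\<close> acquires in \<open>d_scale_E2\<close>.\<close>

lemma scale_E2_bracket:
  assumes "lam = c * mu"
  shows "scale_E2 c (eisenstein_bracket lam f g) = eisenstein_bracket mu (scale_E2 c f) (scale_E2 c g)"
  unfolding eisenstein_bracket_def jacobian_bracket_def d_scale_E2 Delta_def assms
  by (simp add: scale_E2_hom scale_E2_gens const_mult power2_eq_square power3_eq_cube algebra_simps)

lemma poisson_modular_isomorphic_eisenstein: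
  assumes "lam \<noteq> 0" "mu \<noteq> 0"
  shows "poisson_modular_isomorphic (eisenstein_bracket lam) (eisenstein_bracket mu)"
  unfolding poisson_modular_isomorphic_def
proof (intro exI conjI allI)
  show "algebra_iso (scale_E2 (lam / mu))"
    using assms by (intro algebra_iso_scale_E2) simp
  show "scale_E2 (lam / mu) ` modular_algebra \<subseteq> modular_algebra"
    by (auto simp: modular_algebra_def scale_E2_hom)
qed (use assms in \<open>simp add: scale_E2_bracket[of lam "lam / mu" mu]\<close>)

section \<open>The Poisson center\<close>

lemma Delta_nonzero: "Delta \<noteq> 0"
proof
  assume "Delta = 0"
  then have "dz (dz Delta) = 0" by (simp add: eval_d)
  then show False by (simp add: Delta_def eval_d power2_eq_square power3_eq_cube)
qed

text \<open>For a Casimir element \<open>g\<close> the gradient is proportional to \<open>(p, q, r)\<close>, and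
  \<open>2 x p + 4 y q + 6 z r = 0\<close>; hence \<open>g\<close> is killed by the weight derivation.\<close>

lemma poisson_center_eisenstein: "poisson_center (eisenstein_bracket lam) = range const"
proof (intro equalityI subsetI)
  fix g assume "g \<in> poisson_center (eisenstein_bracket lam)"
  then have c: "eisenstein_bracket lam f g = 0" for f by (simp add: poisson_center_def)
  let ?q = "const (1 / 2) * (2 * E4 ^ 2 * E2 - const lam * E4 * E6)"
  let ?r = "- const (1 / 3) * (2 * E6 * E2 - const lam * E4 ^ 2)"
  have 1: "- 2 * Delta * dz g - ?r * dx g = 0" and 2: "2 * Delta * dy g + ?q * dx g = 0"
    using c[of E4] c[of E6] by (simp_all add: eisenstein_bracket_def jacobian_bracket_def eval_d algebra_simps)
  \<comment> \<open>The multipliers 6 z and 4 y produce the z and y parts of the weight field. The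
    remaining factor of \<open>dx g\<close> is -(4 y q + 6 z r) = 2 x p, which is the x
    part.\<close>
  have "- 2 * Delta * weight_field g =
      6 * E6 * (- 2 * Delta * dz g - ?r * dx g) - 4 * E4 * (2 * Delta * dy g + ?q * dx g)"
    unfolding weight_field_def Delta_def const_fractions(1,2) using const_fractions(3) by algebra
  then have "Delta * weight_field g = 0" unfolding 1 2 by simp
  then show "g \<in> range const" using Delta_nonzero by (intro weight_field_eq_0) simp
next
  fix g assume "g \<in> range const"
  then show "g \<in> poisson_center (eisenstein_bracket lam)"
    by (auto simp: poisson_center_def eisenstein_bracket_def jacobian_bracket_def eval_d)
qed

text \<open>Makes precise that the values on the generators define the bracket: they fix the three
  components of its Jacobian form.\<close>

lemma eisenstein_bracket_unique:
  assumes "poisson_bracket b" "b E4 E6 = eisenstein_bracket lam E4 E6"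
    "b E2 E4 = eisenstein_bracket lam E2 E4" "b E2 E6 = eisenstein_bracket lam E2 E6"
  shows "b = eisenstein_bracket lam"
proof -
  have "b E6 E2 = - b E2 E6" using assms(1) unfolding poisson_bracket_def by metis
  then have "b E6 E2 = eisenstein_bracket lam E6 E2"
    unfolding assms eisenstein_bracket_gens by simp
  then show ?thesis
    using poisson_bracket_eq_jacobian[OF assms(1)] assms(2,3)
    by (simp only: eisenstein_bracket_gens eisenstein_bracket_def[symmetric])
qed

theorem propositionA:
  "\<exists>B :: complex \<Rightarrow> qmod \<Rightarrow> qmod \<Rightarrow> qmod.
     (\<forall>lam. lam \<noteq> 0 \<longrightarrow>
        admissible (B lam) \<and>
        B lam E4 E6 = - 2 * Delta \<and>
        B lam E2 E4 = - const (1 / 3) * (2 * E6 * E2 - const lam * E4 ^ 2) \<and>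
        B lam E2 E6 = - const (1 / 2) * (2 * E4 ^ 2 * E2 - const lam * E4 * E6) \<and>
        (\<forall>b. poisson_bracket b \<and> b E4 E6 = B lam E4 E6 \<and> b E2 E4 = B lam E2 E4 \<and>
             b E2 E6 = B lam E2 E6 \<longrightarrow> b = B lam)) \<and>
     (\<forall>lam. lam \<noteq> 0 \<longrightarrow> \<not> unimodular (B lam)) \<and>
     (\<forall>lam mu. lam \<noteq> 0 \<longrightarrow> mu \<noteq> 0 \<longrightarrow> poisson_modular_isomorphic (B lam) (B mu)) \<and>
     (\<forall>lam. lam \<noteq> 0 \<longrightarrow> poisson_center (B lam) = range const)"
proof (intro exI[of _ eisenstein_bracket] conjI allI impI)
  fix lam :: complex and b
  assume "poisson_bracket b \<and> b E4 E6 = eisenstein_bracket lam E4 E6 \<and>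
    b E2 E4 = eisenstein_bracket lam E2 E4 \<and> b E2 E6 = eisenstein_bracket lam E2 E6"
  then show "b = eisenstein_bracket lam"
    by (intro eisenstein_bracket_unique) auto
qed (simp_all add: admissible_eisenstein eisenstein_bracket_gens not_unimodular_eisenstein
    poisson_modular_isomorphic_eisenstein poisson_center_eisenstein)

end
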